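(* Let $\mu$ be a positive $2\pi$-periodic measure on $\mathbb R$ whose restriction to $[0,2\pi)$ is finite and has infinite support (such $\mu$ is PW-sampling). Then $h^\mu$ is constant on each interval $\big(\frac n2,\frac{n+1}2\big)$, $n=0,1,2,\dots$; denoting its value there by $h_n$, $$h_0=\Sigma[\Gamma_1^{-1}]=\gamma_0^{-1},\qquad h_n=\Sigma\big[\Gamma_{n+1}(\mu)^{-1}\big]-\Sigma\big[\Gamma_n(\mu)^{-1}\big]\quad(n\ge1).$$
   Context: Trigonometric moments: $\gamma_k=\frac1{2\pi}\int_{[0,2\pi)}e^{-ikx}\,d\mu(x)$, $k\in\mathbb Z$ (so $\gamma_{-k}=\overline{\gamma_k}$). $\Gamma_n(\mu)$ is the $n\times n$ Toeplitz matrix with entries $(\Gamma_n)_{jk}=\gamma_{k-j}$, $1\le j,k\le n$ (first row $\gamma_0,\gamma_1,\dots,\gamma_{n-1}$); it is positive definite. For a matrix $A=(a_{jk})$, $\Sigma[A]=\sum_{j,k}a_{jk}$. $\mathrm{PW}_t$: entire functions of exponential type at most $t$ in $L^2(\mathbb R)$; $\mathrm{PW}_t(\mu)$ is $\mathrm{PW}_t$ with the $L^2(\mu)$ inner product; $k_t$ is its reproducing kernel at $0$ (i.e. $f(0)=\int f\bar k_t\,d\mu$ for $f\in\mathrm{PW}_t$), and $h^\mu(t)=\pi\frac{d}{dt}k_t(0)$. *)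

theory Defs
  imports "HOL-Analysis.Analysis" "Jordan_Normal_Form.Matrix"
begin

definition restr_support :: "real measure \<Rightarrow> real set \<Rightarrow> real set" where
  "restr_support \<mu> S = {x. \<forall>e>0. emeasure \<mu> (ball x e \<inter> S) > 0}"

definition periodic_sampling_measure :: "real measure \<Rightarrow> bool" where
  "periodic_sampling_measure \<mu> \<longleftrightarrow>
     sets \<mu> = sets borel \<and>
     (\<forall>A\<in>sets borel. emeasure \<mu> ((\<lambda>x. x + 2*pi) ` A) = emeasure \<mu> A) \<and>
     emeasure \<mu> {0..<2*pi} < \<infinity> \<and>
     infinite (restr_support \<mu> {0..<2*pi})"

definition moment :: "real measure \<Rightarrow> int \<Rightarrow> complex" where
  "moment \<mu> k = (1 / (2*pi)) *
     (LINT x|restrict_space \<mu> {0..<2*pi}. cis (- (of_int k * x)))"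

definition toeplitz :: "real measure \<Rightarrow> nat \<Rightarrow> complex mat" where
  "toeplitz \<mu> n = mat n n (\<lambda>(j,k). moment \<mu> (int k - int j))"

definition mat_inv :: "complex mat \<Rightarrow> complex mat" where
  "mat_inv A = (THE B. inverts_mat A B \<and> inverts_mat B A \<and> B \<in> carrier_mat (dim_col A) (dim_row A))"

definition entry_sum :: "complex mat \<Rightarrow> complex" where
  "entry_sum A = (\<Sum>(i,j)\<in>{0..<dim_row A} \<times> {0..<dim_col A}. A $$ (i,j))"

definition PW :: "real \<Rightarrow> (complex \<Rightarrow> complex) set" where
  "PW t = {f. f holomorphic_on UNIV \<and>
     (\<forall>e>0. \<exists>C. \<forall>z. norm (f z) \<le> C * exp ((t + e) * norm z)) \<and>
     integrable lborel (\<lambda>x::real. (norm (f (of_real x)))\<^sup>2)}"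

definition PW_kernel :: "real measure \<Rightarrow> real \<Rightarrow> complex \<Rightarrow> complex" where
  "PW_kernel \<mu> t = (THE k. k \<in> PW t \<and>
     (\<forall>f\<in>PW t. f 0 = (LINT x|\<mu>. f (of_real x) * cnj (k (of_real x)))))"

(* h^mu(t) = pi * d/dt k_t(0) is expressed via derivatives of t \<mapsto> k_t(0) *)

end

theory Submission
  imports Defs "HOL-Complex_Analysis.Complex_Analysis" "HOL-Probability.Sinc_Integral"
    "HOL-Real_Asymp.Real_Asymp" "Jordan_Normal_Form.Determinant"
begin

text \<open>
  Write \<open>2 t = n + r\<close> with \<open>0 < r < 1\<close>. Modulo \<open>1\<close>, a frequency in \<open>(-t, -t + r)\<close> has \<open>n + 1\<close>
  representatives in \<open>[-t, t]\<close> and a frequency in \<open>(-t + r, -t + 1)\<close> has \<open>n\<close>. The Fourier transform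
  of the kernel is constant on each of these short intervals, and its values solve the Toeplitz
  systems of size \<open>n + 1\<close> and \<open>n\<close> with right-hand side \<open>(1, ..., 1)\<close>. Hence
  \<open>2 pi k_t(0)\<close> is \<open>r\<close> times the entry sum of the inverse Toeplitz matrix of size \<open>n + 1\<close> plus \<open>1 - r\<close>
  times that of size \<open>n\<close>, which is affine in \<open>t\<close>.

  The reproducing property needs no Fourier analysis. If \<open>E\<close> is the transform of the indicator of
  one of the two frequency windows and \<open>f\<close> lies in \<open>PW t\<close>, the \<open>2 pi\<close>-periodization of \<open>f E\<close> is an
  entire function of \<open>exp (\<i> z)\<close> of polynomial growth, hence a trigonometric polynomial with as many
  terms as the corresponding Toeplitz system has unknowns. The integral of \<open>f\<close> against the
  kernel is then the sum of the two periodizations at \<open>0\<close>, which is \<open>f 0\<close> because the two windows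
  together form an interval of length \<open>1\<close>. The growth bounds come from the Phragmen--Lindelof principle
  applied to finite linear combinations of translates of \<open>f\<close>.
\<close>

section \<open>Phragmen--Lindelof bounds\<close>

text \<open>The growth half of membership in \<open>PW\<close>, separated from square integrability
  so that it applies to the auxiliary functions built below by integrating or summing translates,
  for which only boundedness on the real line is established.\<close>

definition entire_of_type :: "real \<Rightarrow> (complex \<Rightarrow> complex) \<Rightarrow> bool" where
  "entire_of_type t f \<longleftrightarrow> f holomorphic_on UNIV \<and>
     (\<forall>e>0. \<exists>C. \<forall>z. norm (f z) \<le> C * exp ((t + e) * norm z))"

text \<open>The hypotheses confine s to |arg s| <= pi/8, so |arg (s ^ 3)| <= 3 pi/8, where the
  cosine stays positive. The constant 1/8 comes from the cruder consequence |Im s| <= Re s /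
  2.\<close>

lemma Re_cube_ge:
  fixes s :: complex
  assumes "Re s \<ge> 0" "(Re s)\<^sup>2 - (Im s)\<^sup>2 \<ge> \<bar>2 * Re s * Im s\<bar>"
  shows "Re (s ^ 3) \<ge> norm s ^ 3 / 8"
proof -
  define p q where "p = Re s" and "q = \<bar>Im s\<bar>"
  have p: "p \<ge> 0" and q: "q \<ge> 0" and pq: "p\<^sup>2 - q\<^sup>2 \<ge> 2 * p * q"
    using assms by (auto simp: p_def q_def abs_mult)
  have "2 * q \<le> p"
  proof (rule ccontr)
    assume "\<not> 2 * q \<le> p"
    then have "p < 2 * q" by simp
    moreover have "p * p \<le> p * (2 * q)" using p \<open>p < 2 * q\<close> by (intro mult_left_mono) auto
    moreover have "q * q > 0" using \<open>p < 2 * q\<close> p by simp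
    ultimately show False using pq by (simp add: power2_eq_square)
  qed
  then have q2: "4 * q\<^sup>2 \<le> p\<^sup>2"
    using power_mono[of "2 * q" p 2] q by (simp add: power_mult_distrib)
  have re: "Re (s ^ 3) = p * (p\<^sup>2 - 3 * q\<^sup>2)"
    by (simp add: p_def q_def power3_eq_cube power2_eq_square algebra_simps)
  have "norm s ^ 2 = p\<^sup>2 + q\<^sup>2" by (simp add: cmod_power2 p_def q_def)
  also have "\<dots> \<le> (5/4 * p)\<^sup>2"
  proof -
    have "(5/4 * p)\<^sup>2 = 25/16 * p\<^sup>2" by (simp add: power_mult_distrib power_divide)
    then show ?thesis using q2 zero_le_power2[of p] by linarith
  qed
  finally have "norm s \<le> 5/4 * p" by (rule power2_le_imp_le) (use p in simp)
  then have "norm s ^ 3 \<le> (5/4 * p) ^ 3" by (intro power_mono) auto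
  also have "(5/4 * p) ^ 3 = 125/64 * p ^ 3" by (simp add: power_mult_distrib power_divide)
  also have "\<dots> \<le> 2 * p ^ 3" using zero_le_power[OF p, of 3] by linarith
  finally have 1: "norm s ^ 3 / 8 \<le> p * (p\<^sup>2 / 4)"
    by (simp add: power3_eq_cube power2_eq_square)
  have "p * (p\<^sup>2 / 4) \<le> p * (p\<^sup>2 - 3 * q\<^sup>2)" using p q2 by (intro mult_left_mono) auto
  then show ?thesis using 1 re by simp
qed

text \<open>The parametrisation \<open>z = cis (pi/4) * s\<^sup>2\<close> replaces the customary comparison function
  \<open>z powr (3/2)\<close> by the entire function \<open>s ^ 3\<close>, so that no branch has to be chosen.\<close>

lemma phragmen_lindelof_quadrant:
  fixes g :: "complex \<Rightarrow> complex"
  assumes hol: "g holomorphic_on UNIV"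
    and growth: "\<And>z. norm (g z) \<le> C * exp (K * norm z)"
    and real_axis: "\<And>x. x \<ge> 0 \<Longrightarrow> norm (g (of_real x)) \<le> M"
    and imag_axis: "\<And>y. y \<ge> 0 \<Longrightarrow> norm (g (\<i> * of_real y)) \<le> M"
    and M: "M > 0" and z: "Re z \<ge> 0" "Im z \<ge> 0"
  shows "norm (g z) \<le> M"
proof -
  define k where "k = cis (pi/4)"
  have k: "k = (1 + \<i>) / of_real (sqrt 2)"
    by (simp add: k_def complex_eq_iff cos_45 sin_45 real_div_sqrt field_simps)
  have norm_k [simp]: "norm k = 1" by (simp add: k_def)
  then have k0: "k \<noteq> 0" by (auto simp: k_def)
  \<comment> \<open>\<open>S\<close> is the closed sector |arg s| <= pi/8. Squaring and then
    rotating by \<open>k\<close> carries it onto the first quadrant, and its two edges onto the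
    half-axes on which \<open>g\<close> is bounded by \<open>M\<close>.\<close>
  define S where "S = {s. Re s \<ge> 0 \<and> (Re s)\<^sup>2 - (Im s)\<^sup>2 \<ge> \<bar>2 * Re s * Im s\<bar>}"
  have clS: "closed S" unfolding S_def
    by (intro closed_Collect_conj closed_Collect_le continuous_intros)
  have edge: "norm (g (k * s\<^sup>2)) \<le> M" if "s \<in> S" and "Re s = 0 \<or> (Re s)\<^sup>2 - (Im s)\<^sup>2 = \<bar>2 * Re s * Im s\<bar>" for s
  proof -
    define a where "a = (Re s)\<^sup>2 - (Im s)\<^sup>2"
    have a: "a = \<bar>2 * Re s * Im s\<bar>" using that by (auto simp: S_def a_def)
    have "s\<^sup>2 = Complex a (2 * Re s * Im s)"
      by (simp add: complex_eq_iff a_def power2_eq_square)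
    then have "s\<^sup>2 = Complex a a \<or> s\<^sup>2 = Complex a (-a)" using a by (auto simp: abs_if)
    moreover have "k * Complex a a = \<i> * of_real (a * 2 / sqrt 2)"
      by (simp add: k complex_eq_iff field_simps)
    moreover have "k * Complex a (-a) = of_real (a * 2 / sqrt 2)"
      by (simp add: k complex_eq_iff field_simps)
    moreover have "a * 2 / sqrt 2 \<ge> 0" using a by simp
    ultimately show ?thesis using real_axis imag_axis by metis
  qed
  have growth': "norm (g (k * s\<^sup>2)) \<le> C * exp (K * norm s ^ 2)" for s
    using growth[of "k * s\<^sup>2"] by (simp add: norm_mult norm_power)
  have C: "C \<ge> 0" using growth[of 0] order_trans[OF norm_ge_zero] by fastforce
  \<comment> \<open>By \<open>Re_cube_ge\<close> the factor decays like exp (- d |s|^3 / 8) on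
    \<open>S\<close> and beats the growth exp (K |s|^2). On the arc of a large radius
    \<open>R\<close> the product is then below \<open>M\<close>, so the maximum principle applies to
    the truncated sector; afterwards \<open>d\<close> tends to 0.\<close>
  have damped: "norm (g (k * s\<^sup>2) * exp (- of_real d * s ^ 3)) \<le> M" if d: "d > 0" and s: "s \<in> S" for d s
  proof -
    let ?h = "\<lambda>s. g (k * s\<^sup>2) * exp (- of_real d * s ^ 3)"
    have nh: "norm (?h s) = norm (g (k * s\<^sup>2)) * exp (- d * Re (s ^ 3))" for s
      by (simp add: norm_mult)
    have "((\<lambda>R::real. C * exp (K * R^2 - d * R ^ 3 / 8)) \<longlongrightarrow> 0) at_top"
      using d by real_asymp
    then have "eventually (\<lambda>R. C * exp (K * R^2 - d * R ^ 3 / 8) < M) at_top"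
      using M by (simp add: order_tendstoD(2))
    then have "eventually (\<lambda>R. C * exp (K * R^2 - d * R ^ 3 / 8) < M \<and> norm s \<le> R) at_top"
      using eventually_ge_at_top eventually_conj by blast
    then obtain R where R: "C * exp (K * R^2 - d * R ^ 3 / 8) < M" "norm s \<le> R"
      using eventually_happens trivial_limit_at_top_linorder by blast
    let ?D = "S \<inter> cball 0 R"
    have clD: "closed ?D" using clS by auto
    have "norm (?h s) \<le> M"
    proof (rule maximum_modulus_frontier[where S = ?D and f = ?h])
      have "?h holomorphic_on UNIV"
        by (intro holomorphic_intros holomorphic_on_compose_gen[OF _ hol, unfolded o_def]) auto
      then show "?h holomorphic_on interior ?D" "continuous_on (closure ?D) ?h"
        by (auto intro: holomorphic_on_subset holomorphic_on_imp_continuous_on continuous_on_subset)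
      show "bounded ?D" by auto
      show "s \<in> ?D" using s R by simp
      fix w assume w: "w \<in> frontier ?D"
      have wD: "w \<in> ?D" using w clD by (auto simp: frontier_def)
      have rc: "Re (w ^ 3) \<ge> norm w ^ 3 / 8" using wD Re_cube_ge by (auto simp: S_def)
      then have rc0: "Re (w ^ 3) \<ge> 0" by (smt (verit) divide_nonneg_nonneg norm_ge_zero zero_le_power)
      consider "norm w = R" | "Re w = 0 \<or> (Re w)\<^sup>2 - (Im w)\<^sup>2 = \<bar>2 * Re w * Im w\<bar>"
        | "norm w < R" "Re w > 0" "(Re w)\<^sup>2 - (Im w)\<^sup>2 > \<bar>2 * Re w * Im w\<bar>"
        using wD by (fastforce simp: S_def)
      then show "norm (?h w) \<le> M"
      proof cases
        case 1
        have "norm (?h w) \<le> (C * exp (K * norm w ^ 2)) * exp (- d * (norm w ^ 3 / 8))"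
          unfolding nh using rc d growth'[of w] C
          by (intro mult_mono) (auto simp: mult_left_mono)
        also have "\<dots> = C * exp (K * R^2 - d * R ^ 3 / 8)"
          by (simp add: 1 mult.assoc flip: exp_add)
        finally show ?thesis using R by simp
      next
        case 2
        have "norm (?h w) \<le> norm (g (k * w\<^sup>2)) * 1"
          unfolding nh using rc0 d by (intro mult_left_mono) auto
        then show ?thesis using edge[of w] 2 wD by simp
      next
        case 3
        let ?O = "{s. norm s < R} \<inter> {s. Re s > 0} \<inter> {s. (Re s)\<^sup>2 - (Im s)\<^sup>2 > \<bar>2 * Re s * Im s\<bar>}"
        have "open ?O" by (intro open_Int open_Collect_less continuous_intros)
        moreover have "?O \<subseteq> ?D" by (auto simp: S_def)
        ultimately have "w \<in> interior ?D" using 3 interiorI[of ?O w ?D] by auto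
        then show ?thesis using w by (simp add: frontier_def)
      qed
    qed
    then show ?thesis .
  qed
  \<comment> \<open>The principal root has nonnegative real part, which selects the preimage of
    \<open>z\<close> in the sector \<open>S\<close>.\<close>
  define s where "s = csqrt (z / k)"
  have s2: "s\<^sup>2 = z / k" by (simp add: s_def)
  have zk: "z / k = Complex ((Re z + Im z) / sqrt 2) ((Im z - Re z) / sqrt 2)"
  proof -
    have "k * Complex ((Re z + Im z) / sqrt 2) ((Im z - Re z) / sqrt 2) = z"
      by (simp add: k complex_eq_iff field_simps)
    then show ?thesis using k0 by (metis nonzero_mult_div_cancel_left)
  qed
  have "(Re s)\<^sup>2 - (Im s)\<^sup>2 = Re (s\<^sup>2)" "2 * Re s * Im s = Im (s\<^sup>2)"
    by (simp_all add: power2_eq_square)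
  moreover have "Re (s\<^sup>2) \<ge> \<bar>Im (s\<^sup>2)\<bar>"
    using z by (simp add: s2 zk abs_if divide_right_mono field_simps)
  moreover have "Re s \<ge> 0" using csqrt_principal[of "z/k"] by (auto simp: s_def)
  ultimately have sS: "s \<in> S" by (simp add: S_def)
  have "((\<lambda>d. norm (g (k * s\<^sup>2) * exp (- of_real d * s ^ 3))) \<longlongrightarrow> norm (g (k * s\<^sup>2) * exp (- of_real 0 * s ^ 3))) (at_right (0::real))"
    by (intro tendsto_intros)
  moreover have "eventually (\<lambda>d. norm (g (k * s\<^sup>2) * exp (- of_real d * s ^ 3)) \<le> M) (at_right (0::real))"
    using damped[OF _ sS] by (auto simp: eventually_at_right_less intro: eventually_at_rightI[of 0 1])
  ultimately have "norm (g (k * s\<^sup>2) * exp (- of_real 0 * s ^ 3)) \<le> M"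
    by (intro tendsto_upperbound) auto
  then show ?thesis using k0 by (simp add: s2)
qed

text \<open>Division by 1 - i d z costs nothing on the upper half-plane, where this factor has
  modulus at least 1, and forces decay at infinity. The maximum principle on large half-discs gives
  the bound \<open>B\<close>, and \<open>d\<close> tends to 0.\<close>

lemma bounded_half_plane_max_modulus:
  fixes g :: "complex \<Rightarrow> complex"
  assumes hol: "g holomorphic_on UNIV"
    and bound: "\<And>z. Im z \<ge> 0 \<Longrightarrow> norm (g z) \<le> M"
    and real_axis: "\<And>x. norm (g (of_real x)) \<le> B"
    and B: "B > 0" and z: "Im z \<ge> 0"
  shows "norm (g z) \<le> B"
proof -
  have damped: "norm (g z / (1 - \<i> * of_real d * z)) \<le> B" if d: "d > 0" for d
  proof -
    let ?h = "\<lambda>z. g z / (1 - \<i> * of_real d * z)"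
    have den1: "1 \<le> norm (1 - \<i> * of_real d * w)" if "Im w \<ge> 0" for w
    proof -
      have "1 \<le> Re (1 - \<i> * of_real d * w)" using that d by simp
      also have "\<dots> \<le> norm (1 - \<i> * of_real d * w)" by (rule complex_Re_le_cmod)
      finally show ?thesis .
    qed
    have "((\<lambda>R::real. M / (d * R - 1)) \<longlongrightarrow> 0) at_top" using d by real_asymp
    then have "eventually (\<lambda>R. M / (d * R - 1) < B) at_top" using B by (simp add: order_tendstoD(2))
    then have "eventually (\<lambda>R. M / (d * R - 1) < B \<and> max (norm z) (2 / d) \<le> R) at_top"
      using eventually_ge_at_top eventually_conj by blast
    then obtain R where R: "M / (d * R - 1) < B" "norm z \<le> R" "2 / d \<le> R"
      using eventually_happens trivial_limit_at_top_linorder by (metis (no_types, lifting) max.bounded_iff)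
    let ?D = "{w. Im w \<ge> 0} \<inter> cball 0 R"
    have clD: "closed ?D" by (intro closed_Int closed_Collect_le continuous_intros) auto
    show ?thesis
    proof (rule maximum_modulus_frontier[where S = ?D and f = ?h])
      have "?h holomorphic_on ?D"
        using den1 by (intro holomorphic_intros holomorphic_on_subset[OF hol]) fastforce+
      then show "?h holomorphic_on interior ?D" "continuous_on (closure ?D) ?h"
        using clD holomorphic_on_subset[OF _ interior_subset] holomorphic_on_imp_continuous_on by force+
      show "bounded ?D" by auto
      show "z \<in> ?D" using z R by simp
      fix w assume w: "w \<in> frontier ?D"
      have wD: "w \<in> ?D" using w clD by (auto simp: frontier_def)
      consider "norm w = R" | "Im w = 0" | "norm w < R" "Im w > 0" using wD by fastforce
      then show "norm (?h w) \<le> B"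
      proof cases
        case 1
        have dR: "d * R - 1 \<ge> 1" using R(3) d by (simp add: field_simps)
        have "d * R - 1 \<le> norm (\<i> * of_real d * w) - norm (1::complex)" using 1 d by (simp add: norm_mult)
        also have "\<dots> \<le> norm (1 - \<i> * of_real d * w)" by (metis norm_minus_commute norm_triangle_ineq2)
        finally have "norm (?h w) \<le> M / (d * R - 1)"
          unfolding norm_divide using bound[of w] wD dR order_trans[OF norm_ge_zero bound[of w]]
          by (intro frac_le) auto
        then show ?thesis using R by simp
      next
        case 2
        have "norm (?h w) \<le> norm (g w) / 1"
          unfolding norm_divide using den1[of w] wD by (intro divide_left_mono) auto
        also have "w = of_real (Re w)" using 2 by (simp add: complex_eq_iff)
        finally show ?thesis using real_axis[of "Re w"] \<open>w = of_real (Re w)\<close> by simp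
      next
        case 3
        let ?O = "{s. norm s < R} \<inter> {s. Im s > 0}"
        have "open ?O" by (intro open_Int open_Collect_less continuous_intros)
        moreover have "?O \<subseteq> ?D" by auto
        ultimately have "w \<in> interior ?D" using 3 interiorI[of ?O w ?D] by auto
        then show ?thesis using w by (simp add: frontier_def)
      qed
    qed
  qed
  have "((\<lambda>d. norm (g z / (1 - \<i> * of_real d * z))) \<longlongrightarrow> norm (g z / (1 - \<i> * of_real 0 * z))) (at_right (0::real))"
    by (intro tendsto_intros) auto
  moreover have "eventually (\<lambda>d. norm (g z / (1 - \<i> * of_real d * z)) \<le> B) (at_right (0::real))"
    using damped by (auto intro: eventually_at_rightI[of 0 1])
  ultimately have "norm (g z / (1 - \<i> * of_real 0 * z)) \<le> B"
    by (intro tendsto_upperbound) auto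
  then show ?thesis by simp
qed

text \<open>Multiplication by exp (i (t + e) z) cancels the growth along the positive imaginary
  axis. The quadrant lemma on both sides of that axis gives some bound on the half-plane,
  \<open>bounded_half_plane_max_modulus\<close> improves it to the bound \<open>B\<close> of the
  real axis, and \<open>e\<close> tends to 0.\<close>

lemma phragmen_lindelof_upper:
  assumes F: "entire_of_type t F"
    and real_axis: "\<And>x. norm (F (of_real x)) \<le> B"
    and B: "B > 0" and z: "Im z \<ge> 0"
  shows "norm (F z) \<le> B * exp (t * Im z)"
proof -
  have hol: "F holomorphic_on UNIV" using F by (simp add: entire_of_type_def)
  have *: "norm (F z) \<le> B * exp ((t + e) * Im z)" if e: "e > 0" for e
  proof -
    obtain C where C: "\<And>z. norm (F z) \<le> C * exp ((t + e) * norm z)"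
      using F e by (auto simp: entire_of_type_def)
    define g where "g = (\<lambda>z. F z * exp (\<i> * of_real (t + e) * z))"
    have ng: "norm (g z) = norm (F z) * exp (- (t + e) * Im z)" for z
      by (simp add: g_def norm_mult algebra_simps)
    have holg: "g holomorphic_on UNIV" unfolding g_def by (intro holomorphic_intros hol)
    have C0: "C \<ge> 0" using C[of 0] order_trans[OF norm_ge_zero] by fastforce
    have growth: "norm (g w) \<le> C * exp ((2 * \<bar>t + e\<bar>) * norm w)" for w
    proof -
      have "norm (g w) \<le> C * exp ((t + e) * norm w) * exp (- (t + e) * Im w)"
        unfolding ng using C by (intro mult_right_mono) auto
      also have "\<dots> = C * exp ((t + e) * norm w + - (t + e) * Im w)" by (simp only: exp_add mult.assoc)
      also have "(t + e) * norm w + - (t + e) * Im w \<le> \<bar>t + e\<bar> * norm w + \<bar>t + e\<bar> * norm w"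
      proof (rule add_mono)
        show "(t + e) * norm w \<le> \<bar>t + e\<bar> * norm w" by (intro mult_right_mono) auto
        have "- (t + e) * Im w \<le> \<bar>t + e\<bar> * \<bar>Im w\<bar>" by (metis abs_ge_self abs_minus abs_mult)
        also have "\<dots> \<le> \<bar>t + e\<bar> * norm w" by (intro mult_left_mono abs_Im_le_cmod) auto
        finally show "- (t + e) * Im w \<le> \<bar>t + e\<bar> * norm w" .
      qed
      finally show ?thesis using C0 by (simp add: mult_left_mono mult_ac)
    qed
    have real: "norm (g (of_real x)) \<le> B" for x using real_axis[of x] by (simp add: ng)
    have imag: "norm (g (\<i> * of_real y)) \<le> C" if "y \<ge> 0" for y
    proof -
      have "norm (g (\<i> * of_real y)) \<le> (C * exp ((t + e) * y)) * exp (- (t + e) * y)"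
        unfolding ng using C[of "\<i> * of_real y"] that by (auto simp: norm_mult intro!: mult_right_mono)
      also have "\<dots> = C" by (simp add: mult.assoc algebra_simps flip: exp_add)
      finally show ?thesis .
    qed
    have bound: "norm (g w) \<le> max B C" if w: "Im w \<ge> 0" for w
    proof (cases "Re w \<ge> 0")
      case True
      show ?thesis
        by (rule phragmen_lindelof_quadrant[OF holg growth])
          (use real imag B True w in \<open>auto simp: max.coboundedI1 max.coboundedI2\<close>)
    next
      case False
      \<comment> \<open>The second quadrant is rotated onto the first, so the roles of the two axes
        change: the new imaginary half-axis is the negative real axis.\<close>
      have hol': "(\<lambda>w. g (\<i> * w)) holomorphic_on UNIV"
        by (intro holomorphic_on_compose_gen[OF _ holg, unfolded o_def] holomorphic_intros) auto
      have growth': "norm (g (\<i> * w)) \<le> C * exp ((2 * \<bar>t + e\<bar>) * norm w)" for w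
        using growth[of "\<i> * w"] by (simp add: norm_mult)
      have neg: "\<i> * (\<i> * of_real y) = of_real (- y)" for y by (simp add: complex_eq_iff)
      have "norm ((\<lambda>w. g (\<i> * w)) (- \<i> * w)) \<le> max B C"
      proof (rule phragmen_lindelof_quadrant[OF hol' growth'])
        show "norm (g (\<i> * (\<i> * of_real y))) \<le> max B C" for y
          unfolding neg using real[of "- y"] by simp
      qed (use imag B False w in \<open>auto simp: max.coboundedI2\<close>)
      then show ?thesis by simp
    qed
    have "norm (g z) \<le> B"
      by (rule bounded_half_plane_max_modulus[OF holg bound real B z])
    then have "norm (F z) * exp (- (t + e) * Im z) * exp ((t + e) * Im z) \<le> B * exp ((t + e) * Im z)"
      by (intro mult_right_mono) (auto simp: ng)
    then show ?thesis by (simp add: mult.assoc algebra_simps flip: exp_add)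
  qed
  have "((\<lambda>e. B * exp ((t + e) * Im z)) \<longlongrightarrow> B * exp ((t + 0) * Im z)) (at_right 0)"
    by (intro tendsto_intros)
  moreover have "eventually (\<lambda>e. norm (F z) \<le> B * exp ((t + e) * Im z)) (at_right 0)"
    using * by (auto intro: eventually_at_rightI[of 0 1])
  ultimately have "norm (F z) \<le> B * exp ((t + 0) * Im z)" by (intro tendsto_lowerbound) auto
  then show ?thesis by simp
qed

lemma phragmen_lindelof:
  assumes F: "entire_of_type t F"
    and real_axis: "\<And>x. norm (F (of_real x)) \<le> B" and B: "B > 0"
  shows "norm (F z) \<le> B * exp (t * \<bar>Im z\<bar>)"
proof (cases "Im z \<ge> 0")
  case True
  then show ?thesis using phragmen_lindelof_upper[OF assms] by simp
next
  case False
  \<comment> \<open>The lower half-plane is reduced to the upper one by z -> -z.\<close>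
  have "entire_of_type t (\<lambda>z. F (- z))"
    unfolding entire_of_type_def
  proof (intro conjI allI impI)
    show "(\<lambda>z. F (- z)) holomorphic_on UNIV"
      using F by (intro holomorphic_on_compose_gen[of uminus _ F UNIV, unfolded o_def])
        (auto simp: entire_of_type_def intro: holomorphic_intros)
    fix e :: real assume "e > 0"
    then obtain C where "\<And>z. norm (F z) \<le> C * exp ((t + e) * norm z)"
      using F by (auto simp: entire_of_type_def)
    then show "\<exists>C. \<forall>z. norm (F (- z)) \<le> C * exp ((t + e) * norm z)" by (metis norm_minus_cancel)
  qed
  then have "norm (F (- (- z))) \<le> B * exp (t * Im (- z))"
    by (rule phragmen_lindelof_upper) (use real_axis B False in \<open>auto simp flip: of_real_minus\<close>)
  then show ?thesis using False by simp
qed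

section \<open>Sampling bounds in the Paley--Wiener space\<close>

lemma mem_PW_iff:
  "f \<in> PW t \<longleftrightarrow> entire_of_type t f \<and> integrable lborel (\<lambda>x::real. (norm (f (of_real x)))\<^sup>2)"
  by (simp add: PW_def entire_of_type_def)

section \<open>Stability of exponential type under translations and linear combinations\<close>

lemma entire_of_type_shift:
  assumes f: "entire_of_type t f" and t: "t \<ge> 0"
  shows "entire_of_type t (\<lambda>z. f (z + c))"
  unfolding entire_of_type_def
proof (intro conjI allI impI)
  have hol: "f holomorphic_on UNIV" using f by (simp add: entire_of_type_def)
  show "(\<lambda>z. f (z + c)) holomorphic_on UNIV"
    by (intro holomorphic_on_compose_gen[OF _ hol, unfolded o_def] holomorphic_intros) auto
  fix e :: real assume e: "e > 0"
  then obtain C where C: "\<And>z. norm (f z) \<le> C * exp ((t + e) * norm z)"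
    using f by (auto simp: entire_of_type_def)
  have C0: "C \<ge> 0" using C[of 0] order_trans[OF norm_ge_zero] by fastforce
  have "norm (f (z + c)) \<le> (C * exp ((t + e) * norm c)) * exp ((t + e) * norm z)" for z
  proof -
    have "norm (f (z + c)) \<le> C * exp ((t + e) * norm (z + c))" by (rule C)
    also have "\<dots> \<le> C * exp ((t + e) * (norm z + norm c))"
      using C0 t e by (intro mult_left_mono) (auto intro!: mult_left_mono norm_triangle_ineq)
    finally show ?thesis by (simp add: distrib_left exp_add mult_ac)
  qed
  then show "\<exists>C. \<forall>z. norm (f (z + c)) \<le> C * exp ((t + e) * norm z)" by blast
qed

lemma entire_of_type_0: "entire_of_type t (\<lambda>z. 0)"
  unfolding entire_of_type_def by (auto intro: exI[of _ 0])

lemma entire_of_type_add: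
  assumes "entire_of_type t f" "entire_of_type t g"
  shows "entire_of_type t (\<lambda>z. f z + g z)"
  unfolding entire_of_type_def
proof (intro conjI allI impI)
  show "(\<lambda>z. f z + g z) holomorphic_on UNIV"
    using assms by (auto simp: entire_of_type_def intro: holomorphic_intros)
  fix e :: real assume e: "e > 0"
  obtain C D where "\<And>z. norm (f z) \<le> C * exp ((t + e) * norm z)" "\<And>z. norm (g z) \<le> D * exp ((t + e) * norm z)"
    using assms e unfolding entire_of_type_def by meson
  then have "norm (f z + g z) \<le> (C + D) * exp ((t + e) * norm z)" for z
    by (intro norm_triangle_le) (simp add: distrib_right add_mono)
  then show "\<exists>C. \<forall>z. norm (f z + g z) \<le> C * exp ((t + e) * norm z)" by blast
qed

lemma entire_of_type_cmult:
  assumes "entire_of_type t f"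
  shows "entire_of_type t (\<lambda>z. c * f z)"
  unfolding entire_of_type_def
proof (intro conjI allI impI)
  show "(\<lambda>z. c * f z) holomorphic_on UNIV"
    using assms by (auto simp: entire_of_type_def intro: holomorphic_intros)
  fix e :: real assume e: "e > 0"
  obtain C where C: "\<And>z. norm (f z) \<le> C * exp ((t + e) * norm z)"
    using assms e unfolding entire_of_type_def by meson
  have "norm (c * f z) \<le> (norm c * C) * exp ((t + e) * norm z)" for z
    using mult_left_mono[OF C[of z] norm_ge_zero[of c]] by (simp add: norm_mult mult_ac)
  then show "\<exists>C. \<forall>z. norm (c * f z) \<le> C * exp ((t + e) * norm z)" by blast
qed

lemma entire_of_type_sum:
  assumes "\<And>i. i \<in> I \<Longrightarrow> entire_of_type t (f i)"
  shows "entire_of_type t (\<lambda>z. \<Sum>i\<in>I. f i z)"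
  using assms
proof (induction I rule: infinite_finite_induct)
  case (insert i I)
  then show ?case by (simp add: entire_of_type_add)
qed (auto intro: entire_of_type_0)

lemma continuous_on_entire_compose:
  assumes "f holomorphic_on UNIV" "continuous_on S g"
  shows "continuous_on S (\<lambda>x. f (g x))"
  using continuous_on_compose2[OF holomorphic_on_imp_continuous_on[OF assms(1)] assms(2)] by simp

text \<open>Weighted arithmetic-geometric mean inequality. In the two sampling estimates the weight
  \<open>l\<close> is the growth factor of a Phragmen-Lindelof bound, so that the quantity being
  estimated reappears with coefficient 1/2 and can be absorbed.\<close>

lemma norm_mult_le_weighted:
  fixes a b :: complex
  assumes "l > 0"
  shows "norm (a * b) \<le> l / 2 * (norm a)\<^sup>2 + 1 / (2 * l) * (norm b)\<^sup>2"
proof -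
  have "0 \<le> (l * norm a - norm b)\<^sup>2 / (2 * l)" using assms by simp
  also have "\<dots> = l / 2 * (norm a)\<^sup>2 + 1 / (2 * l) * (norm b)\<^sup>2 - norm a * norm b"
    using assms by (simp add: power2_eq_square field_simps)
  finally show ?thesis by (simp add: norm_mult)
qed

section \<open>From square integrability to uniform bounds on sampling sums\<close>

lemma PW_interval_bound:
  assumes f: "f \<in> PW t"
  obtains N where "N > 0" "\<And>a b. integral {a..b} (\<lambda>x::real. (norm (f (of_real x)))\<^sup>2) \<le> N"
proof -
  let ?q = "\<lambda>x::real. (norm (f (of_real x)))\<^sup>2"
  let ?N = "LINT x|lborel. ?q x"
  have int: "integrable lborel ?q" using f by (simp add: mem_PW_iff)
  have "integral {a..b} ?q \<le> ?N" for a b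
  proof -
    have s: "set_integrable lborel {a..b} ?q"
      unfolding set_integrable_def by (intro integrable_mult_indicator int) auto
    have "integral {a..b} ?q = (LINT x:{a..b}|lborel. ?q x)"
      using set_borel_integral_eq_integral(2)[OF s] by simp
    also have "\<dots> \<le> ?N"
      unfolding set_lebesgue_integral_def
      by (intro integral_mono int s[unfolded set_integrable_def]) (auto simp: indicator_def)
    finally show ?thesis .
  qed
  moreover have "?N \<ge> 0" by simp
  ultimately show ?thesis using that[of "?N + 1"] by (smt (verit))
qed

text \<open>Testing against \<open>f'\<close> on a window turns an \<open>L\<^sup>2\<close> bound for \<open>f\<close> into a sup bound for an
  entire function of the same type, to which Phragmen--Lindelof and Cauchy's estimate apply.\<close>

lemma PW_deriv_interval_bound:
  assumes f: "f \<in> PW t" and t: "t \<ge> 0"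
  obtains N where "\<And>a b. integral {a..b} (\<lambda>x::real. (norm (deriv f (of_real x)))\<^sup>2) \<le> N"
proof -
  obtain N where N: "N > 0" "\<And>a b. integral {a..b} (\<lambda>x::real. (norm (f (of_real x)))\<^sup>2) \<le> N"
    using PW_interval_bound[OF f] by blast
  have hol: "f holomorphic_on UNIV" and type: "entire_of_type t f"
    using f by (auto simp: mem_PW_iff entire_of_type_def)
  have hol': "deriv f holomorphic_on UNIV" by (rule holomorphic_deriv[OF hol open_UNIV])
  note [continuous_intros] = continuous_on_entire_compose[OF hol] continuous_on_entire_compose[OF hol']
  have symmetric: "integral {-A..A} (\<lambda>x::real. (norm (deriv f (of_real x)))\<^sup>2) \<le> exp t ^ 2 * N" if A: "A \<ge> 0" for A
  proof -
    \<comment> \<open>\<open>F\<close> correlates \<open>f\<close> with its derivative on the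
      window, so F' at 0 is exactly the integral \<open>G\<close> to be bounded, while on the real
      axis \<open>F\<close> involves translates of \<open>f\<close>, whose square integrals are at
      most \<open>N\<close>.\<close>
    define F where "F z = integral (cbox (-A) A) (\<lambda>u::real. f (z + of_real u) * cnj (deriv f (of_real u)))" for z
    define G where "G = integral {-A..A} (\<lambda>x::real. (norm (deriv f (of_real x)))\<^sup>2)"
    have G0: "G \<ge> 0" unfolding G_def by (intro integral_nonneg integrable_continuous_interval continuous_intros) auto
    have F': "(F has_field_derivative
        integral (cbox (-A) A) (\<lambda>u::real. deriv f (z + of_real u) * cnj (deriv f (of_real u)))) (at z)" for z
      unfolding F_def
    proof (rule leibniz_rule_field_derivative[where U = UNIV])
      fix x :: complex and u :: real
      have "(f has_field_derivative deriv f (x + of_real u)) (at (x + of_real u))"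
        using hol by (simp add: holomorphic_derivI)
      then have "((\<lambda>x. f (x + of_real u)) has_field_derivative deriv f (x + of_real u)) (at x)"
        by (simp add: DERIV_shift)
      then show "((\<lambda>x. f (x + of_real u) * cnj (deriv f (of_real u))) has_field_derivative
          deriv f (x + of_real u) * cnj (deriv f (of_real u))) (at x)"
        by (rule DERIV_cmult_right)
    next
      show "(\<lambda>u::real. f (x + of_real u) * cnj (deriv f (of_real u))) integrable_on cbox (- A) A" for x
        by (intro integrable_continuous continuous_intros)
      show "continuous_on (UNIV \<times> cbox (- A) A) (\<lambda>(x, u::real). deriv f (x + of_real u) * cnj (deriv f (of_real u)))"
        unfolding split_beta by (intro continuous_intros)
    qed auto
    have holF: "F holomorphic_on UNIV" using F' by (auto simp: holomorphic_on_def field_differentiable_def)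
    have typeF: "entire_of_type t F"
      unfolding entire_of_type_def
    proof (intro conjI allI impI holF)
      fix e :: real assume e: "e > 0"
      then obtain C where C: "\<And>z. norm (f z) \<le> C * exp ((t + e) * norm z)"
        using type by (auto simp: entire_of_type_def)
      have C0: "C \<ge> 0" using C[of 0] order_trans[OF norm_ge_zero] by fastforce
      have "compact ((\<lambda>u::real. deriv f (of_real u)) ` {-A..A})"
        by (intro compact_continuous_image continuous_intros) auto
      then obtain D where D: "\<And>u::real. u \<in> {-A..A} \<Longrightarrow> norm (deriv f (of_real u)) \<le> D"
        using compact_imp_bounded bounded_iff by (metis imageI)
      have "norm (F z) \<le> (C * exp ((t + e) * A) * D * (A - - A)) * exp ((t + e) * norm z)" for z
      proof -
        have "norm (F z) \<le> (C * exp ((t + e) * (norm z + A)) * D) * (A - - A)"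
          unfolding F_def cbox_interval
        proof (rule integral_bound)
          fix u :: real assume u: "u \<in> {-A..A}"
          have "norm (f (z + of_real u)) \<le> C * exp ((t + e) * norm (z + of_real u))" by (rule C)
          also have "\<dots> \<le> C * exp ((t + e) * (norm z + A))"
            using C0 t e u norm_triangle_ineq[of z "of_real u"]
            by (intro mult_left_mono) (auto intro!: mult_left_mono)
          finally show "norm (f (z + of_real u) * cnj (deriv f (of_real u))) \<le> C * exp ((t + e) * (norm z + A)) * D"
            using D[OF u] C0 by (auto simp: norm_mult intro!: mult_mono)
        qed (use A in \<open>auto intro!: continuous_intros\<close>)
        then show ?thesis by (simp add: distrib_left exp_add mult_ac)
      qed
      then show "\<exists>C. \<forall>z. norm (F z) \<le> C * exp ((t + e) * norm z)" by blast
    qed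
    \<comment> \<open>The weight \<open>exp t\<close> matches the factor lost on the unit circle in
      Cauchy's estimate: \<open>B * exp t\<close> contains \<open>G / 2\<close>, which is absorbed
      and leaves a bound independent of \<open>A\<close>.\<close>
    define B where "B = exp t / 2 * N + 1 / (2 * exp t) * G"
    have B: "B > 0" unfolding B_def using N G0 by (intro add_pos_nonneg) auto
    have realF: "norm (F (of_real x)) \<le> B" for x
    proof -
      let ?a = "\<lambda>u::real. (norm (f (of_real x + of_real u)))\<^sup>2" and ?b = "\<lambda>u::real. (norm (deriv f (of_real u)))\<^sup>2"
      have "norm (F (of_real x)) \<le> integral {-A..A} (\<lambda>u. exp t / 2 * ?a u + 1 / (2 * exp t) * ?b u)"
        unfolding F_def cbox_interval
      proof (rule integral_norm_bound_integral)
        fix u assume "u \<in> {-A..A}"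
        show "norm (f (of_real x + of_real u) * cnj (deriv f (of_real u))) \<le> exp t / 2 * ?a u + 1 / (2 * exp t) * ?b u"
          using norm_mult_le_weighted[of "exp t" "f (of_real x + of_real u)" "cnj (deriv f (of_real u))"] by simp
      qed (intro integrable_continuous_interval continuous_intros)+
      also have "\<dots> = exp t / 2 * integral {-A..A} ?a + 1 / (2 * exp t) * integral {-A..A} ?b"
        by (subst integral_add) (auto intro!: integrable_continuous_interval continuous_intros)
      also have "integral {-A..A} ?a = integral {-A + x..A + x} (\<lambda>u. (norm (f (of_real u)))\<^sup>2)"
        by (subst integral_shift[symmetric]) (auto intro!: continuous_intros simp: o_def add.commute)
      also have "exp t / 2 * \<dots> \<le> exp t / 2 * N" by (intro mult_left_mono N) auto
      finally show ?thesis by (simp add: B_def G_def)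
    qed
    have "norm ((deriv ^^ 1) F 0) \<le> fact 1 * (B * exp t) / 1 ^ 1"
    proof (rule Cauchy_inequality)
      show "F holomorphic_on ball 0 1" "continuous_on (cball 0 1) F"
        using holF by (auto intro: holomorphic_on_subset continuous_on_subset holomorphic_on_imp_continuous_on)
      fix z :: complex assume "norm (0 - z) = 1"
      then have "\<bar>Im z\<bar> \<le> 1" using abs_Im_le_cmod[of z] by simp
      then have "t * \<bar>Im z\<bar> \<le> t * 1" using t by (intro mult_left_mono) auto
      then show "norm (F z) \<le> B * exp t"
        using phragmen_lindelof[OF typeF realF B, of z] B
        by (smt (verit) exp_le_cancel_iff mult_left_mono mult.right_neutral)
    qed auto
    moreover have "deriv F 0 = of_real G"
    proof -
      have "deriv F 0 = integral {-A..A} (\<lambda>u::real. deriv f (of_real u) * cnj (deriv f (of_real u)))"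
        using DERIV_imp_deriv[OF F'[of 0]] by simp
      also have "\<dots> = integral {-A..A} (\<lambda>u::real. of_real ((norm (deriv f (of_real u)))\<^sup>2))"
        by (simp only: complex_norm_square)
      also have "\<dots> = of_real G" unfolding G_def
        by (intro integral_unique has_integral_of_real integrable_integral integrable_continuous_interval continuous_intros)
      finally show ?thesis .
    qed
    ultimately have "G \<le> B * exp t" using G0 by simp
    also have "\<dots> = exp t ^ 2 * N / 2 + G / 2" by (simp add: B_def field_simps power2_eq_square)
    finally show ?thesis by (simp add: G_def)
  qed
  show ?thesis
  proof
    fix a b :: real
    have "integral {a..b} (\<lambda>x::real. (norm (deriv f (of_real x)))\<^sup>2)
        \<le> integral {-(\<bar>a\<bar> + \<bar>b\<bar>)..\<bar>a\<bar> + \<bar>b\<bar>} (\<lambda>x::real. (norm (deriv f (of_real x)))\<^sup>2)"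
      by (intro integral_subset_le integrable_continuous_interval continuous_intros) auto
    also have "\<dots> \<le> exp t ^ 2 * N" by (rule symmetric) auto
    finally show "integral {a..b} (\<lambda>x::real. (norm (deriv f (of_real x)))\<^sup>2) \<le> exp t ^ 2 * N" .
  qed
qed

text \<open>The weight \<open>w\<close> falls linearly from 1 at \<open>x\<close> to 0 at
  \<open>x + 2*pi\<close>, so |f(x)|^2 is minus the integral of the derivative of
  \<open>w * q\<close>. That derivative is controlled by |f|^2 and |f'|^2.\<close>

lemma norm_square_le_window_integral:
  assumes hol: "f holomorphic_on UNIV"
  shows "(norm (f (of_real x)))\<^sup>2 \<le>
    integral {x..x + 2*pi} (\<lambda>u::real. 2 * (norm (f (of_real u)))\<^sup>2 + (norm (deriv f (of_real u)))\<^sup>2)"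
proof -
  have hol': "deriv f holomorphic_on UNIV" by (rule holomorphic_deriv[OF hol open_UNIV])
  note [continuous_intros] = continuous_on_entire_compose[OF hol] continuous_on_entire_compose[OF hol']
  define q where "q u = (norm (f (of_real u)))\<^sup>2" for u :: real
  define w where "w u = (x + 2*pi - u) / (2*pi)" for u :: real
  define D where "D u = 2 * (f (of_real u) \<bullet> deriv f (of_real u))" for u :: real
  have dq: "(q has_vector_derivative D u) (at u)" for u
  proof -
    have 1: "((\<lambda>u::real. f (of_real u)) has_vector_derivative deriv f (of_real u)) (at u)"
      using hol by (intro has_vector_derivative_real_field) (simp add: holomorphic_derivI)
    have "((\<lambda>u::real. f (of_real u) \<bullet> f (of_real u)) has_vector_derivative
        (f (of_real u) \<bullet> deriv f (of_real u) + deriv f (of_real u) \<bullet> f (of_real u))) (at u)"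
      by (rule bounded_bilinear.has_vector_derivative[OF bounded_bilinear_inner 1 1])
    then show ?thesis by (simp add: q_def[abs_def] D_def power2_norm_eq_inner inner_commute)
  qed
  have dw: "(w has_vector_derivative (- 1 / (2*pi))) (at u)" for u
    unfolding w_def[abs_def] has_real_derivative_iff_has_vector_derivative[symmetric]
    by (auto intro!: derivative_eq_intros)
  have ftc: "((\<lambda>u. w u * D u + (- 1 / (2*pi)) * q u) has_integral w (x + 2*pi) * q (x + 2*pi) - w x * q x) {x..x + 2*pi}"
    by (rule fundamental_theorem_of_calculus, simp)
      (rule has_vector_derivative_at_within[OF has_vector_derivative_mult[OF dw dq]])
  then have 1: "((\<lambda>u. - (w u * D u + (- 1 / (2*pi)) * q u)) has_integral q x) {x..x + 2*pi}"
    using has_integral_neg[OF ftc] by (simp add: w_def)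
  have "q x = integral {x..x + 2*pi} (\<lambda>u. - (w u * D u + (- 1 / (2*pi)) * q u))"
    using 1 by (simp add: integral_unique)
  also have "\<dots> \<le> integral {x..x + 2*pi} (\<lambda>u::real. 2 * (norm (f (of_real u)))\<^sup>2 + (norm (deriv f (of_real u)))\<^sup>2)"
  proof (rule integral_le)
    show "(\<lambda>u. - (w u * D u + (- 1 / (2*pi)) * q u)) integrable_on {x..x + 2*pi}" using 1 by blast
    show "(\<lambda>u::real. 2 * (norm (f (of_real u)))\<^sup>2 + (norm (deriv f (of_real u)))\<^sup>2) integrable_on {x..x + 2*pi}"
      by (intro integrable_continuous_interval continuous_intros)
    fix u assume u: "u \<in> {x..x + 2*pi}"
    have w01: "0 \<le> w u" "w u \<le> 1" using u by (auto simp: w_def divide_simps)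
    have "\<bar>D u\<bar> \<le> 2 * (norm (f (of_real u)) * norm (deriv f (of_real u)))"
      unfolding D_def using Cauchy_Schwarz_ineq2[of "f (of_real u)" "deriv f (of_real u)"] by (simp add: abs_mult)
    also have "\<dots> \<le> (norm (f (of_real u)))\<^sup>2 + (norm (deriv f (of_real u)))\<^sup>2"
      using sum_squares_bound[of "norm (f (of_real u))" "norm (deriv f (of_real u))"] by simp
    finally have D: "\<bar>D u\<bar> \<le> (norm (f (of_real u)))\<^sup>2 + (norm (deriv f (of_real u)))\<^sup>2" .
    have "- (w u * D u) \<le> \<bar>w u * D u\<bar>" by simp
    also have "\<dots> \<le> 1 * \<bar>D u\<bar>" unfolding abs_mult using w01 by (intro mult_right_mono) auto
    finally have "- (w u * D u) \<le> \<bar>D u\<bar>" by simp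
    moreover have "1 / (2*pi) * q u \<le> 1 * q u"
      using pi_gt3 by (intro mult_right_mono) (auto simp: q_def)
    ultimately show "- (w u * D u + (- 1 / (2*pi)) * q u) \<le> 2 * (norm (f (of_real u)))\<^sup>2 + (norm (deriv f (of_real u)))\<^sup>2"
      using D by (simp add: q_def)
  qed
  finally show ?thesis by (simp add: q_def)
qed

text \<open>The windows attached to the points x + 2 pi j are adjacent, so the local bounds add up
  to one integral over a long interval, which is bounded independently of its ends.\<close>

lemma PW_real_sample_bound:
  assumes f: "f \<in> PW t" and t: "t \<ge> 0"
  obtains S where "S > 0" "\<And>(x::real) k. (\<Sum>j<k. (norm (f (of_real (x + 2*pi*real j))))\<^sup>2) \<le> S"
proof -
  obtain N where N: "N > 0" "\<And>a b. integral {a..b} (\<lambda>x::real. (norm (f (of_real x)))\<^sup>2) \<le> N"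
    using PW_interval_bound[OF f] by blast
  obtain N' where N': "\<And>a b. integral {a..b} (\<lambda>x::real. (norm (deriv f (of_real x)))\<^sup>2) \<le> N'"
    using PW_deriv_interval_bound[OF f t] by blast
  have hol: "f holomorphic_on UNIV" using f by (auto simp: mem_PW_iff entire_of_type_def)
  have hol': "deriv f holomorphic_on UNIV" by (rule holomorphic_deriv[OF hol open_UNIV])
  note [continuous_intros] = continuous_on_entire_compose[OF hol] continuous_on_entire_compose[OF hol']
  let ?w = "\<lambda>u::real. 2 * (norm (f (of_real u)))\<^sup>2 + (norm (deriv f (of_real u)))\<^sup>2"
  have int: "?w integrable_on {a..b}" for a b
    by (intro integrable_continuous_interval continuous_intros)
  have "(\<Sum>j<k. (norm (f (of_real (x + 2*pi*real j))))\<^sup>2) \<le> integral {x..x + 2*pi*real k} ?w" for x k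
  proof (induction k)
    case (Suc k)
    have "(norm (f (of_real (x + 2*pi*real k))))\<^sup>2 \<le> integral {x + 2*pi*real k..x + 2*pi*real k + 2*pi} ?w"
      by (rule norm_square_le_window_integral[OF hol])
    also have "x + 2*pi*real k + 2*pi = x + 2*pi*real (Suc k)" by (simp add: algebra_simps)
    finally have "(\<Sum>j<Suc k. (norm (f (of_real (x + 2*pi*real j))))\<^sup>2)
       \<le> integral {x..x + 2*pi*real k} ?w + integral {x + 2*pi*real k..x + 2*pi*real (Suc k)} ?w"
      using Suc by simp
    also have "\<dots> = integral {x..x + 2*pi*real (Suc k)} ?w"
      by (intro Henstock_Kurzweil_Integration.integral_combine int) auto
    finally show ?case .
  qed simp
  also have "integral {a..b} ?w \<le> 2 * N + N'" for a b
  proof -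
    have "integral {a..b} ?w = 2 * integral {a..b} (\<lambda>x::real. (norm (f (of_real x)))\<^sup>2) + integral {a..b} (\<lambda>x::real. (norm (deriv f (of_real x)))\<^sup>2)"
      by (subst integral_add) (auto intro!: integrable_continuous_interval continuous_intros)
    then show ?thesis using N(2)[of a b] N'[of a b] by simp
  qed
  finally have "(\<Sum>j<k. (norm (f (of_real (x + 2*pi*real j))))\<^sup>2) \<le> 2 * N + N'" for x k .
  \<comment> \<open>The interval from 1 to 0 is empty and its integral is 0.\<close>
  moreover have "N' \<ge> 0" using N'[of 1 0] by simp
  ultimately show ?thesis using that[of "2 * N + N'"] N(1) by simp
qed

text \<open>Duality: with the conjugated sample values at \<open>z\<close> as coefficients, a
  combination \<open>F\<close> of translates of \<open>f\<close> takes the value \<open>G\<close>,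
  the sum of squares itself, at \<open>z\<close>. On the real axis \<open>F\<close> is bounded
  through \<open>PW_real_sample_bound\<close>, and Phragmen-Lindelof carries this to height
  \<open>Im z\<close>.\<close>

lemma PW_sample_bound:
  assumes f: "f \<in> PW t" and t: "t \<ge> 0"
  obtains S where "S > 0"
    "\<And>z k. (\<Sum>j<k. (norm (f (z + of_real (2*pi*real j))))\<^sup>2) \<le> S * exp (2 * t * \<bar>Im z\<bar>)"
proof -
  obtain S where S: "S > 0" "\<And>(x::real) k. (\<Sum>j<k. (norm (f (of_real (x + 2*pi*real j))))\<^sup>2) \<le> S"
    using PW_real_sample_bound[OF f t] by blast
  have type: "entire_of_type t f" using f by (simp add: mem_PW_iff)
  have "(\<Sum>j<k. (norm (f (z + of_real (2*pi*real j))))\<^sup>2) \<le> S * exp (2 * t * \<bar>Im z\<bar>)" for z k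
  proof -
    define c where "c j = f (z + of_real (2*pi*real j))" for j
    define G where "G = (\<Sum>j<k. (norm (c j))\<^sup>2)"
    define l where "l = exp (t * \<bar>Im z\<bar>)"
    define F where "F w = (\<Sum>j<k. cnj (c j) * f (w + of_real (2*pi*real j)))" for w
    have G0: "G \<ge> 0" and l: "l > 0" by (auto simp: G_def l_def intro: sum_nonneg)
    have typeF: "entire_of_type t F"
      unfolding F_def by (intro entire_of_type_sum entire_of_type_cmult entire_of_type_shift type t)
    have "norm (F (of_real x)) \<le> l / 2 * S + 1 / (2 * l) * G" for x
    proof -
      have "norm (F (of_real x)) \<le> (\<Sum>j<k. l / 2 * (norm (f (of_real (x + 2*pi*real j))))\<^sup>2 + 1 / (2 * l) * (norm (c j))\<^sup>2)"
        unfolding F_def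
      proof (rule sum_norm_le)
        fix j
        show "norm (cnj (c j) * f (of_real x + of_real (2*pi*real j)))
          \<le> l / 2 * (norm (f (of_real (x + 2*pi*real j))))\<^sup>2 + 1 / (2 * l) * (norm (c j))\<^sup>2"
          using norm_mult_le_weighted[OF l, of "f (of_real x + of_real (2*pi*real j))" "cnj (c j)"]
          by (simp add: mult.commute)
      qed
      also have "\<dots> = l / 2 * (\<Sum>j<k. (norm (f (of_real (x + 2*pi*real j))))\<^sup>2) + 1 / (2 * l) * G"
        by (simp only: sum.distrib G_def sum_distrib_left)
      also have "\<dots> \<le> l / 2 * S + 1 / (2 * l) * G"
        using l by (intro add_right_mono mult_left_mono S) auto
      finally show ?thesis .
    qed
    moreover have "l / 2 * S + 1 / (2 * l) * G > 0" using l S G0 by (intro add_pos_nonneg) auto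
    ultimately have "norm (F z) \<le> (l / 2 * S + 1 / (2 * l) * G) * l"
      using phragmen_lindelof[OF typeF, of _ z] by (simp add: l_def)
    also have "\<dots> = l\<^sup>2 * S / 2 + G / 2" using l by (simp add: field_simps power2_eq_square)
    finally have "norm (F z) \<le> l\<^sup>2 * S / 2 + G / 2" .
    moreover have "F z = of_real G"
      by (simp add: F_def G_def c_def complex_norm_square mult.commute del: of_real_power)
    ultimately have "G \<le> S * l\<^sup>2" using G0 by (simp add: mult.commute)
    also have "l\<^sup>2 = exp (2 * t * \<bar>Im z\<bar>)" by (simp add: l_def power2_eq_square flip: exp_add)
    finally show ?thesis by (simp add: G_def c_def)
  qed
  then show ?thesis using that S by blast
qed

section \<open>Frequency windows and periodizations\<close>

text \<open>The Fourier transform of the indicator of a frequency interval, extended to complex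
  arguments. The integral form needs no case distinction at z = 0.\<close>

definition window_ft :: "real \<Rightarrow> real \<Rightarrow> complex \<Rightarrow> complex" where
  "window_ft \<alpha> \<beta> z = integral {\<alpha>..\<beta>} (\<lambda>\<xi>. exp (- (\<i> * z * of_real \<xi>)))"

lemma window_ft_holomorphic: "window_ft \<alpha> \<beta> holomorphic_on UNIV"
proof -
  have "(window_ft \<alpha> \<beta> has_field_derivative
      integral (cbox \<alpha> \<beta>) (\<lambda>\<xi>. - (\<i> * of_real \<xi>) * exp (- (\<i> * z * of_real \<xi>)))) (at z)" for z
    unfolding window_ft_def[abs_def] cbox_interval[symmetric]
  proof (rule leibniz_rule_field_derivative[where U = UNIV])
    fix x :: complex and \<xi> :: real
    show "((\<lambda>z. exp (- (\<i> * z * of_real \<xi>))) has_field_derivative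
        - (\<i> * of_real \<xi>) * exp (- (\<i> * x * of_real \<xi>))) (at x)"
      by (auto intro!: derivative_eq_intros)
    show "(\<lambda>\<xi>. exp (- (\<i> * x * of_real \<xi>))) integrable_on cbox \<alpha> \<beta>"
      by (intro integrable_continuous continuous_intros)
  qed (auto simp: split_beta intro!: continuous_intros)
  then show ?thesis by (auto simp: holomorphic_on_def field_differentiable_def)
qed

lemma norm_exp_window: "norm (exp (- (\<i> * z * of_real \<xi>))) = exp (\<xi> * Im z)"
  by (simp add: mult.commute)

lemma mult_le_max_endpoints:
  fixes y :: real
  assumes "\<alpha> \<le> \<xi>" "\<xi> \<le> \<beta>"
  shows "\<xi> * y \<le> max (\<alpha> * y) (\<beta> * y)"
  using assms by (cases "y \<ge> 0") (auto simp: le_max_iff_disj mult_right_mono mult_right_mono_neg)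

lemma norm_window_ft_le:
  assumes "\<alpha> \<le> \<beta>"
  shows "norm (window_ft \<alpha> \<beta> z) \<le> exp (max (\<alpha> * Im z) (\<beta> * Im z)) * (\<beta> - \<alpha>)"
  unfolding window_ft_def
  by (rule integral_bound[OF assms])
    (auto intro!: continuous_intros mult_le_max_endpoints simp only: norm_exp_window exp_le_cancel_iff atLeastAtMost_iff)

lemma window_ft_eq:
  assumes "z \<noteq> 0" "\<alpha> \<le> \<beta>"
  shows "window_ft \<alpha> \<beta> z = (exp (- (\<i> * z * of_real \<alpha>)) - exp (- (\<i> * z * of_real \<beta>))) / (\<i> * z)"
proof -
  let ?F = "\<lambda>\<xi>::real. exp (- (\<i> * z * of_real \<xi>)) / (- (\<i> * z))"
  have "((\<lambda>\<xi>::real. exp (- (\<i> * z * of_real \<xi>))) has_integral ?F \<beta> - ?F \<alpha>) {\<alpha>..\<beta>}"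
  proof (rule fundamental_theorem_of_calculus[OF assms(2)])
    fix \<xi> :: real
    have "((\<lambda>w. exp (- (\<i> * z * w)) / (- (\<i> * z))) has_field_derivative exp (- (\<i> * z * of_real \<xi>))) (at (of_real \<xi>))"
      using assms(1) by (auto intro!: derivative_eq_intros)
    then show "(?F has_vector_derivative exp (- (\<i> * z * of_real \<xi>))) (at \<xi> within {\<alpha>..\<beta>})"
      by (rule has_vector_derivative_at_within[OF has_vector_derivative_real_field])
  qed
  then have "window_ft \<alpha> \<beta> z = ?F \<beta> - ?F \<alpha>"
    unfolding window_ft_def by (rule integral_unique)
  then show ?thesis by (simp add: diff_divide_distrib)
qed

text \<open>For |z| <= 1 the length of the window gives the bound; for |z| > 1 the closed form gains
  1/|z|, and 2 |z|^2 >= 1 + |z|^2 turns the factor 4 into 8. The decay is summable along shifts by 2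
  pi.\<close>

lemma norm_window_ft_square_le:
  assumes "\<alpha> \<le> \<beta>" "\<beta> \<le> \<alpha> + 1"
  shows "(norm (window_ft \<alpha> \<beta> z))\<^sup>2 \<le> 8 * (exp (max (\<alpha> * Im z) (\<beta> * Im z)))\<^sup>2 / (1 + (norm z)\<^sup>2)"
proof -
  let ?e = "exp (max (\<alpha> * Im z) (\<beta> * Im z))"
  show ?thesis
  proof (cases "norm z \<le> 1")
    case True
    have "norm (window_ft \<alpha> \<beta> z) \<le> ?e * 1"
      using norm_window_ft_le[OF assms(1), of z] assms by (elim order_trans) (intro mult_left_mono, auto)
    then have "(norm (window_ft \<alpha> \<beta> z))\<^sup>2 \<le> ?e\<^sup>2" by (intro power_mono) auto
    also have "\<dots> = 2 * ?e\<^sup>2 / 2" by simp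
    also have "\<dots> \<le> 8 * ?e\<^sup>2 / (1 + (norm z)\<^sup>2)"
      using power_le_one[OF norm_ge_zero True, of 2] by (intro frac_le) (auto simp: add_pos_nonneg)
    finally show ?thesis .
  next
    case False
    then have z: "norm z > 1" "z \<noteq> 0" by auto
    have "norm (window_ft \<alpha> \<beta> z) = norm (exp (- (\<i> * z * of_real \<alpha>)) - exp (- (\<i> * z * of_real \<beta>))) / norm z"
      by (simp add: window_ft_eq[OF z(2) assms(1)] norm_divide norm_mult)
    also have "\<dots> \<le> (?e + ?e) / norm z"
      by (intro divide_right_mono order_trans[OF norm_triangle_ineq4] add_mono) (simp_all only: norm_exp_window exp_le_cancel_iff, auto)
    finally have "(norm (window_ft \<alpha> \<beta> z))\<^sup>2 \<le> ((?e + ?e) / norm z)\<^sup>2" by (intro power_mono) auto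
    also have "\<dots> = 8 * ?e\<^sup>2 / (2 * (norm z)\<^sup>2)" by (simp add: power_divide power2_eq_square)
    also have "\<dots> \<le> 8 * ?e\<^sup>2 / (1 + (norm z)\<^sup>2)"
      using one_le_power[of "norm z" 2] z by (intro divide_left_mono) (auto simp: add_pos_nonneg)
    finally show ?thesis .
  qed
qed

lemma window_ft_combine:
  assumes "\<alpha> \<le> \<beta>" "\<beta> \<le> \<gamma>"
  shows "window_ft \<alpha> \<beta> z + window_ft \<beta> \<gamma> z = window_ft \<alpha> \<gamma> z"
  unfolding window_ft_def
  by (intro Henstock_Kurzweil_Integration.integral_combine assms integrable_continuous_interval continuous_intros)

lemma window_ft_0: "\<alpha> \<le> \<beta> \<Longrightarrow> window_ft \<alpha> \<beta> 0 = of_real (\<beta> - \<alpha>)"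
  by (simp add: window_ft_def scaleR_conv_of_real)

text \<open>At these arguments the exponential has period 1 in the frequency and mean zero. This
  collapses a periodization against a unit window to its term at 0.\<close>

lemma window_ft_unit_period:
  assumes "m \<noteq> 0"
  shows "window_ft \<alpha> (\<alpha> + 1) (of_real (2 * pi * of_int m)) = 0"
proof -
  have "exp (- (\<i> * of_real (2 * pi * of_int m) * of_real (\<alpha> + 1)))
      = exp (- (\<i> * of_real (2 * pi * of_int m) * of_real \<alpha>) + \<i> * (of_int (- m) * (of_real pi * 2)))"
    by (simp add: algebra_simps)
  also have "\<dots> = exp (- (\<i> * of_real (2 * pi * of_int m) * of_real \<alpha>))"
    unfolding exp_add exp_2pi_1_int by simp
  finally show ?thesis
    using assms by (subst window_ft_eq) auto
qed

text \<open>Each term is compared with the increment of arctan (u / Y) over a step of length 2 pi;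
  the increments telescope to at most pi. The gained factor 1 / Y provides the decay in the
  imaginary direction.\<close>

lemma sum_inverse_square_shifts_le:
  fixes x Y :: real
  assumes Y: "Y \<ge> 1"
  shows "(\<Sum>j<k. 1 / (Y\<^sup>2 + (x + 2*pi*real j)\<^sup>2)) \<le> (2 + 8 * pi\<^sup>2) * pi / Y"
proof -
  let ?c = "2 + 8 * pi\<^sup>2"
  have step: "1 / (Y\<^sup>2 + u\<^sup>2) \<le> ?c / Y * (arctan ((u + 2*pi) / Y) - arctan (u / Y))" for u
  proof -
    have "\<exists>v. u < v \<and> v < u + 2*pi \<and> arctan ((u + 2*pi) / Y) - arctan (u / Y) = (u + 2*pi - u) * (1 / (1 + (v / Y)\<^sup>2) * (1 / Y))"
      using Y by (intro MVT2) (auto intro!: derivative_eq_intros simp: field_simps)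
    then obtain v where v: "u < v" "v < u + 2*pi"
      "arctan ((u + 2*pi) / Y) - arctan (u / Y) = 2 * pi * (1 / (1 + (v / Y)\<^sup>2) * (1 / Y))" by auto
    \<comment> \<open>The parallelogram identity trades the unknown intermediate point
      \<open>v\<close> for \<open>u\<close>, at the price of the constant \<open>?c\<close>.\<close>
    have "v\<^sup>2 + (v - 2 * u)\<^sup>2 = 2 * u\<^sup>2 + 2 * (v - u)\<^sup>2" by (simp add: power2_eq_square algebra_simps)
    moreover have "(v - u)\<^sup>2 \<le> 4 * pi\<^sup>2"
      using v power_mono[of "v - u" "2*pi" 2] by (simp add: power_mult_distrib)
    ultimately have "v\<^sup>2 \<le> 2 * u\<^sup>2 + 8 * pi\<^sup>2"
      using zero_le_power2[of "v - 2 * u"] by linarith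
    moreover have "8 * pi\<^sup>2 * 1 \<le> 8 * pi\<^sup>2 * (Y\<^sup>2 + u\<^sup>2)"
      using one_le_power[OF Y, of 2] by (intro mult_left_mono) (auto intro: add_increasing2)
    moreover have "?c * (Y\<^sup>2 + u\<^sup>2) = 2 * Y\<^sup>2 + 2 * u\<^sup>2 + 8 * pi\<^sup>2 * (Y\<^sup>2 + u\<^sup>2)" by (simp add: algebra_simps)
    ultimately have "Y\<^sup>2 + v\<^sup>2 \<le> ?c * (Y\<^sup>2 + u\<^sup>2)"
      using zero_le_power2[of Y] by linarith
    then have "1 / (Y\<^sup>2 + u\<^sup>2) \<le> ?c / (Y\<^sup>2 + v\<^sup>2)"
      using Y by (simp add: field_simps add_pos_nonneg)
    also have "\<dots> \<le> 2 * pi * (?c / (Y\<^sup>2 + v\<^sup>2))"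
      using pi_gt3 Y mult_right_mono[of 1 "2 * pi" "?c / (Y\<^sup>2 + v\<^sup>2)"] by auto
    also have "\<dots> = ?c / Y * (2 * pi * (1 / (1 + (v / Y)\<^sup>2) * (1 / Y)))"
      using Y by (simp add: power_divide divide_simps power2_eq_square add_pos_nonneg)
    finally show ?thesis using v by simp
  qed
  have "(\<Sum>j<k. 1 / (Y\<^sup>2 + (x + 2*pi*real j)\<^sup>2))
      \<le> (\<Sum>j<k. ?c / Y * (arctan ((x + 2*pi*real (Suc j)) / Y) - arctan ((x + 2*pi*real j) / Y)))"
    by (intro sum_mono order_trans[OF step]) (simp add: algebra_simps)
  also have "\<dots> = ?c / Y * (arctan ((x + 2*pi*real k) / Y) - arctan (x / Y))"
    by (subst sum_distrib_left[symmetric], subst sum_lessThan_telescope) simp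
  also have "\<dots> \<le> ?c / Y * pi"
    using Y arctan_bounded[of "(x + 2*pi*real k) / Y"] arctan_bounded[of "x / Y"]
    by (intro mult_left_mono) auto
  finally show ?thesis by simp
qed

text \<open>Cauchy-Schwarz separates the samples of \<open>f\<close> from those of the window
  transform. The fourth root in the denominator is what later turns a bound O(w ^ N) into o(w ^ N)
  and so saves one coefficient.\<close>

lemma PW_window_sum_bound:
  assumes f: "f \<in> PW t" and t: "t \<ge> 0" and ab: "\<alpha> \<le> \<beta>" "\<beta> \<le> \<alpha> + 1"
  obtains D where "D > 0"
    "\<And>z k. (\<Sum>j<k. norm (f (z + of_real (2*pi*real j)) * window_ft \<alpha> \<beta> (z + of_real (2*pi*real j))))
       \<le> D * exp (t * \<bar>Im z\<bar> + max (\<alpha> * Im z) (\<beta> * Im z)) / sqrt (sqrt (1 + (Im z)\<^sup>2))"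
proof -
  obtain S where S: "S > 0"
    "\<And>z k. (\<Sum>j<k. (norm (f (z + of_real (2*pi*real j))))\<^sup>2) \<le> S * exp (2 * t * \<bar>Im z\<bar>)"
    using PW_sample_bound[OF f t] by blast
  define c where "c = (2 + 8 * pi\<^sup>2) * pi"
  have c: "c > 0" by (simp add: c_def add_pos_nonneg)
  define D where "D = sqrt (S * (8 * c))"
  have "(\<Sum>j<k. norm (f (z + of_real (2*pi*real j)) * window_ft \<alpha> \<beta> (z + of_real (2*pi*real j))))
       \<le> D * exp (t * \<bar>Im z\<bar> + max (\<alpha> * Im z) (\<beta> * Im z)) / sqrt (sqrt (1 + (Im z)\<^sup>2))" for z k
  proof (rule power2_le_imp_le)
    let ?e = "exp (max (\<alpha> * Im z) (\<beta> * Im z))"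
    define Y where "Y = sqrt (1 + (Im z)\<^sup>2)"
    have Y: "Y \<ge> 1" and Y2: "Y\<^sup>2 = 1 + (Im z)\<^sup>2" by (simp_all add: Y_def)
    have "(\<Sum>j<k. (norm (window_ft \<alpha> \<beta> (z + of_real (2*pi*real j))))\<^sup>2)
        \<le> (\<Sum>j<k. 8 * ?e\<^sup>2 * (1 / (Y\<^sup>2 + (Re z + 2*pi*real j)\<^sup>2)))"
    proof (rule sum_mono)
      fix j
      have "1 + (norm (z + of_real (2*pi*real j)))\<^sup>2 = Y\<^sup>2 + (Re z + 2*pi*real j)\<^sup>2"
        by (simp add: Y2 cmod_power2)
      then show "(norm (window_ft \<alpha> \<beta> (z + of_real (2*pi*real j))))\<^sup>2 \<le> 8 * ?e\<^sup>2 * (1 / (Y\<^sup>2 + (Re z + 2*pi*real j)\<^sup>2))"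
        using norm_window_ft_square_le[OF ab, of "z + of_real (2*pi*real j)"] by simp
    qed
    also have "\<dots> = 8 * ?e\<^sup>2 * (\<Sum>j<k. 1 / (Y\<^sup>2 + (Re z + 2*pi*real j)\<^sup>2))"
      by (rule sum_distrib_left[symmetric])
    also have "\<dots> \<le> 8 * ?e\<^sup>2 * (c / Y)"
      unfolding c_def using sum_inverse_square_shifts_le[OF Y] by (intro mult_left_mono) auto
    finally have W: "(\<Sum>j<k. (norm (window_ft \<alpha> \<beta> (z + of_real (2*pi*real j))))\<^sup>2) \<le> 8 * ?e\<^sup>2 * (c / Y)" .
    have "(\<Sum>j<k. norm (f (z + of_real (2*pi*real j)) * window_ft \<alpha> \<beta> (z + of_real (2*pi*real j))))\<^sup>2
        \<le> (\<Sum>j<k. (norm (f (z + of_real (2*pi*real j))))\<^sup>2) * (\<Sum>j<k. (norm (window_ft \<alpha> \<beta> (z + of_real (2*pi*real j))))\<^sup>2)"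
      unfolding norm_mult by (rule Cauchy_Schwarz_ineq_sum)
    also have "\<dots> \<le> (S * exp (2 * t * \<bar>Im z\<bar>)) * (8 * ?e\<^sup>2 * (c / Y))"
      using S W by (intro mult_mono) (auto intro!: sum_nonneg)
    also have "exp (2 * t * \<bar>Im z\<bar>) = (exp (t * \<bar>Im z\<bar>))\<^sup>2" by (simp add: power2_eq_square flip: exp_add)
    also have "(S * (exp (t * \<bar>Im z\<bar>))\<^sup>2) * (8 * ?e\<^sup>2 * (c / Y))
        = (D * exp (t * \<bar>Im z\<bar> + max (\<alpha> * Im z) (\<beta> * Im z)) / sqrt Y)\<^sup>2"
      using S c Y by (simp add: D_def exp_add power_mult_distrib power_divide)
    finally show "(\<Sum>j<k. norm (f (z + of_real (2*pi*real j)) * window_ft \<alpha> \<beta> (z + of_real (2*pi*real j))))\<^sup>2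
        \<le> (D * exp (t * \<bar>Im z\<bar> + max (\<alpha> * Im z) (\<beta> * Im z)) / sqrt (sqrt (1 + (Im z)\<^sup>2)))\<^sup>2"
      by (simp add: Y_def)
    show "0 \<le> D * exp (t * \<bar>Im z\<bar> + max (\<alpha> * Im z) (\<beta> * Im z)) / sqrt (sqrt (1 + (Im z)\<^sup>2))"
      using S c by (simp add: D_def)
  qed
  then show ?thesis using that[of D] S c by (auto simp: D_def)
qed

section \<open>Periodizations as trigonometric polynomials\<close>

lemma entire_eq_polynomial_if_little_o_power:
  assumes hol: "h holomorphic_on UNIV" and lim: "((\<lambda>w. h w / w ^ N) \<longlongrightarrow> 0) at_infinity"
  obtains A :: "nat \<Rightarrow> complex" where "\<And>w. h w = (\<Sum>j<N. A j * w ^ j)"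
proof -
  define A where "A k = (deriv ^^ k) h 0 / fact k" for k
  have "eventually (\<lambda>w. norm (h w / w ^ N) < 1) at_infinity"
    using order_tendstoD(2)[OF tendsto_norm_zero[OF lim], of 1] by simp
  then obtain R where R: "\<And>w. norm w \<ge> R \<Longrightarrow> norm (h w / w ^ N) < 1"
    by (auto simp: eventually_at_infinity)
  have "norm (h w) \<le> 1 * norm w ^ N" if w: "norm w \<ge> max R 1" for w
  proof -
    have "norm w ^ N > 0" using w by (intro zero_less_power) linarith
    then show ?thesis using R[of w] w by (simp add: norm_divide norm_power divide_less_eq)
  qed
  then have poly: "h w = (\<Sum>k\<le>N. A k * w ^ k)" for w
    unfolding A_def by (rule Liouville_polynomial[OF hol])
  have poly': "h w = (\<Sum>k<N. A k * w ^ k) + A N * w ^ N" for w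
    unfolding poly using sum.lessThan_Suc[of _ N] by (simp flip: lessThan_Suc_atMost)
  have "((\<lambda>w::complex. (\<Sum>k<N. A k * (1 / w ^ (N - k))) + A N) \<longlongrightarrow> (\<Sum>k<N. A k * 0) + A N) at_infinity"
  proof (intro tendsto_intros)
    fix k assume "k \<in> {..<N}"
    then have "filterlim (\<lambda>w::complex. w ^ (N - k)) at_infinity at_infinity"
      by (intro filterlim_power_at_infinity filterlim_ident) auto
    then show "((\<lambda>w::complex. 1 / w ^ (N - k)) \<longlongrightarrow> 0) at_infinity"
      using tendsto_divide_0[OF tendsto_const] by blast
  qed
  moreover have "eventually (\<lambda>w::complex. (\<Sum>k<N. A k * (1 / w ^ (N - k))) + A N = h w / w ^ N) at_infinity"
    using eventually_not_equal_at_infinity[of 0]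
  proof eventually_elim
    case (elim w)
    have "A k * (1 / w ^ (N - k)) = A k * w ^ k / w ^ N" if "k < N" for k
      using that elim by (simp add: power_diff)
    then show ?case using elim by (simp add: poly' add_divide_distrib sum_divide_distrib)
  qed
  ultimately have "((\<lambda>w. h w / w ^ N) \<longlongrightarrow> (\<Sum>k<N. A k * 0) + A N) at_infinity"
    using filterlim_cong[OF refl refl] by fast
  \<comment> \<open>Liouville allows degree \<open>N\<close>; the little-o hypothesis removes the
    top coefficient, leaving as many coefficients as the Toeplitz system of size \<open>N\<close>
    has unknowns.\<close>
  then have "A N = 0" using tendsto_unique[OF trivial_limit_at_infinity lim] by fastforce
  then show ?thesis using that[of A] poly' by simp
qed

text \<open>The sum over all shifts in 2 pi Z as a one-sided series: the shift i is paired with -(i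
  + 1), so every integer occurs exactly once.\<close>

definition periodization :: "(complex \<Rightarrow> complex) \<Rightarrow> complex \<Rightarrow> complex" where
  "periodization G z = (\<Sum>i. G (z + of_real (2*pi*real i)) + G (z - of_real (2*pi*real (Suc i))))"

text \<open>The first \<open>k\<close> pairs use the shifts -k, ..., k - 1, a block of consecutive
  shifts. Bounds for one-sided sums with arbitrary starting point therefore apply to the
  pairs.\<close>

lemma symmetric_window_sum:
  fixes h :: "'b::real_normed_algebra_1 \<Rightarrow> 'a::comm_monoid_add"
  shows "(\<Sum>i<k. h (z + of_real (2*pi*real i)) + h (z - of_real (2*pi*real (Suc i))))
    = (\<Sum>j<2 * k. h ((z - of_real (2*pi*real k)) + of_real (2*pi*real j)))"
proof -
  let ?g = "\<lambda>j. h ((z - of_real (2*pi*real k)) + of_real (2*pi*real j))"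
  have "(\<Sum>j<k + m. ?g j) = (\<Sum>j<k. ?g j) + (\<Sum>i<m. ?g (k + i))" for m
    by (induction m) (simp_all only: add_Suc_right sum.lessThan_Suc add.assoc add_0_right lessThan_0 sum.empty)
  then have "(\<Sum>j<2 * k. ?g j) = (\<Sum>j<k. ?g j) + (\<Sum>i<k. ?g (k + i))"
    unfolding mult_2 .
  also have "(\<Sum>j<k. ?g j) = (\<Sum>i<k. ?g (k - Suc i))" by (rule sum.nat_diff_reindex[symmetric])
  also have "\<dots> = (\<Sum>i<k. h (z - of_real (2*pi*real (Suc i))))"
    by (intro sum.cong arg_cong[of _ _ h]) (auto simp: of_nat_diff algebra_simps)
  also have "(\<Sum>i<k. ?g (k + i)) = (\<Sum>i<k. h (z + of_real (2*pi*real i)))"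
    by (intro sum.cong arg_cong[of _ _ h]) (auto simp: algebra_simps)
  finally show ?thesis by (simp add: sum.distrib add.commute)
qed

context
  fixes G :: "complex \<Rightarrow> complex" and W :: "real \<Rightarrow> real"
  assumes hol: "G holomorphic_on UNIV"
    and W: "\<And>z k. (\<Sum>j<k. norm (G (z + of_real (2*pi*real j)))) \<le> W (Im z)"
begin

lemma symmetric_window_norm_sum_le:
  "(\<Sum>i<k. norm (G (z + of_real (2*pi*real i))) + norm (G (z - of_real (2*pi*real (Suc i))))) \<le> W (Im z)"
  using W[where k = "2 * k" and z = "z - of_real (2*pi*real k)"] by (subst symmetric_window_sum[of "\<lambda>z. norm (G z)"]) simp

lemma periodization_summable_norm:
  "summable (\<lambda>i. norm (G (z + of_real (2*pi*real i))) + norm (G (z - of_real (2*pi*real (Suc i)))))"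
  by (rule summableI_nonneg_bounded[OF _ symmetric_window_norm_sum_le]) auto

lemma periodization_sums:
  "(\<lambda>i. G (z + of_real (2*pi*real i)) + G (z - of_real (2*pi*real (Suc i)))) sums periodization G z"
proof -
  have "summable (\<lambda>i. G (z + of_real (2*pi*real i)) + G (z - of_real (2*pi*real (Suc i))))"
    by (rule summable_comparison_test'[OF periodization_summable_norm[of z]]) (rule norm_triangle_ineq)
  then show ?thesis unfolding periodization_def by (rule summable_sums)
qed

lemma symmetric_partial_sum_norm_le:
  "norm (\<Sum>i<k. G (z + of_real (2*pi*real i)) + G (z - of_real (2*pi*real (Suc i)))) \<le> W (Im z)"
  by (rule order_trans[OF sum_norm_le[OF norm_triangle_ineq] symmetric_window_norm_sum_le])

lemma norm_periodization_le: "norm (periodization G z) \<le> W (Im z)"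
  using periodization_sums[of z] symmetric_partial_sum_norm_le[where z = z]
  unfolding sums_def by (intro tendsto_upperbound[OF tendsto_norm]) auto

text \<open>The partial sums are bounded by \<open>W (Im z)\<close>, hence uniformly on compact
  sets. By Montel a subsequence has a holomorphic limit, which the pointwise convergence identifies
  with the periodization.\<close>

lemma periodization_holomorphic:
  assumes contW: "continuous_on UNIV W"
  shows "periodization G holomorphic_on UNIV"
proof -
  define P where "P k z = (\<Sum>i<k. G (z + of_real (2*pi*real i)) + G (z - of_real (2*pi*real (Suc i))))" for k z
  obtain g r where g: "g holomorphic_on UNIV" "strict_mono (r :: nat \<Rightarrow> nat)"
    and lim: "\<And>z. z \<in> UNIV \<Longrightarrow> ((\<lambda>n. P (r n) z) \<longlongrightarrow> g z) sequentially"
  proof (rule Montel[of UNIV "range P" P])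
    show "h holomorphic_on UNIV" if "h \<in> range P" for h
      using that unfolding P_def[abs_def]
      by (auto intro!: holomorphic_intros holomorphic_on_compose_gen[OF _ hol, unfolded o_def])
    fix K :: "complex set" assume K: "compact K"
    have "compact ((\<lambda>z. W (Im z)) ` K)"
      by (intro compact_continuous_image continuous_on_compose2[OF contW] continuous_intros K) auto
    then obtain B where "\<And>z. z \<in> K \<Longrightarrow> norm (W (Im z)) \<le> B"
      using compact_imp_bounded bounded_iff by (metis imageI)
    then have "norm (P k z) \<le> B" if "z \<in> K" for k z
      using symmetric_partial_sum_norm_le[where k = k and z = z] that unfolding P_def by (smt (verit) real_norm_def)
    then show "\<exists>B. \<forall>h\<in>range P. \<forall>z\<in>K. norm (h z) \<le> B" by blast
  qed auto
  have "periodization G z = g z" for z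
  proof -
    have "(\<lambda>k. P k z) \<longlonglongrightarrow> periodization G z" using periodization_sums[of z] by (simp add: sums_def P_def)
    then have "(\<lambda>n. P (r n) z) \<longlonglongrightarrow> periodization G z" using LIMSEQ_subseq_LIMSEQ[OF _ g(2)] by (simp add: o_def)
    then show ?thesis using LIMSEQ_unique lim by blast
  qed
  then have "periodization G = g" by blast
  then show ?thesis using g by simp
qed

text \<open>A shift by one period changes a partial sum in its two end terms, which tend to 0 by
  summability.\<close>

lemma periodization_add_period: "periodization G (z + of_real (2*pi)) = periodization G z"
proof -
  let ?P = "\<lambda>k z. (\<Sum>i<k. G (z + of_real (2*pi*real i)) + G (z - of_real (2*pi*real (Suc i))))"
  have shift: "?P k (z + of_real (2*pi)) = ?P k z + (G (z + of_real (2*pi*real k)) - G (z - of_real (2*pi*real k)))" for k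
    by (induction k) (auto simp: algebra_simps)
  have L: "(\<lambda>k. norm (G (z + of_real (2*pi*real k))) + norm (G (z - of_real (2*pi*real (Suc k))))) \<longlonglongrightarrow> 0"
    by (rule summable_LIMSEQ_zero[OF periodization_summable_norm])
  have "(\<lambda>k. G (z + of_real (2*pi*real k))) \<longlonglongrightarrow> 0" "(\<lambda>k. G (z - of_real (2*pi*real (Suc k)))) \<longlonglongrightarrow> 0"
    by (rule Lim_null_comparison[OF always_eventually L]; simp)+
  note this(1) LIMSEQ_imp_Suc[OF this(2)]
  then have "(\<lambda>k. G (z + of_real (2*pi*real k)) - G (z - of_real (2*pi*real k))) \<longlonglongrightarrow> 0 - 0"
    by (rule tendsto_diff)
  moreover have "(\<lambda>k. ?P k z) \<longlonglongrightarrow> periodization G z" using periodization_sums by (simp add: sums_def)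
  ultimately have "(\<lambda>k. ?P k (z + of_real (2*pi))) \<longlonglongrightarrow> periodization G z"
    unfolding shift by (auto intro: tendsto_eq_intros)
  moreover have "(\<lambda>k. ?P k (z + of_real (2*pi))) \<longlonglongrightarrow> periodization G (z + of_real (2*pi))"
    using periodization_sums by (simp add: sums_def)
  ultimately show ?thesis using LIMSEQ_unique by blast
qed

lemma periodization_add_periods: "periodization G (z + of_real (2*pi * of_int n)) = periodization G z"
proof -
  have nat: "periodization G (z + of_real (2*pi*real n)) = periodization G z" for z n
  proof (induction n)
    case (Suc n)
    have "z + of_real (2*pi*real (Suc n)) = (z + of_real (2*pi*real n)) + of_real (2*pi)" by (simp add: algebra_simps)
    then show ?case using Suc periodization_add_period by metis
  qed simp
  show ?thesis
  proof (cases n)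
    case (nonneg m)
    then show ?thesis using nat[of z m] by simp
  next
    case (neg m)
    have "(z + of_real (2*pi * of_int n)) + of_real (2*pi*real (Suc m)) = z"
      unfolding neg by (simp add: algebra_simps)
    then show ?thesis using nat[of "z + of_real (2*pi * of_int n)" "Suc m"] by metis
  qed
qed

text \<open>In the variable \<open>w = exp (\<i> * z)\<close> the periodization has a removable singularity at \<open>0\<close>
  and is \<open>o(w ^ N)\<close> at infinity.\<close>

lemma periodization_eq_trig_polynomial:
  assumes contW: "continuous_on UNIV W"
    and upper: "((\<lambda>y. W y * exp (- y)) \<longlongrightarrow> 0) at_top"
    and lower: "((\<lambda>y. W (- y) * exp (- (real N * y))) \<longlongrightarrow> 0) at_top"
  obtains A where "\<And>z. periodization G z = (\<Sum>j<N. A j * exp (\<i> * z) ^ j)"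
proof -
  let ?T = "periodization G"
  have holT: "?T holomorphic_on UNIV" by (rule periodization_holomorphic[OF contW])
  have expT: "?T (- \<i> * a) = ?T (- \<i> * b)" if ab: "exp a = exp b" for a b
  proof -
    obtain n :: int where "a = b + (of_int (2 * n) * pi) * \<i>"
      using iffD1[OF exp_eq ab] by blast
    then have "- \<i> * a = - \<i> * b + of_real (2*pi * of_int n)" by (simp add: algebra_simps)
    then show ?thesis by (metis periodization_add_periods)
  qed
  \<comment> \<open>By \<open>expT\<close> the value does not depend on the choice of the logarithm,
    so \<open>H\<close> is the periodization as a function of w = exp (i z), with |w| = exp (- Im
    z).\<close>
  define H where "H w = ?T (- \<i> * Ln w)" for w
  have nH: "norm (H w) \<le> W (- ln (norm w))" if "w \<noteq> 0" for w
    using norm_periodization_le[of "- \<i> * Ln w"] that by (simp add: H_def)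
  have "H holomorphic_on (- \<real>\<^sub>\<le>\<^sub>0)"
    unfolding H_def[abs_def] by (intro holomorphic_on_compose_gen[OF _ holT, unfolded o_def] holomorphic_intros) auto
  \<comment> \<open>Across the negative half-axis the branch
    \<open>Ln (- w) + \<i> * of_real pi\<close> is used; the two slit planes together cover the
    punctured plane.\<close>
  moreover have "H holomorphic_on (uminus ` (- \<real>\<^sub>\<le>\<^sub>0))"
  proof (rule holomorphic_transform)
    show "(\<lambda>w. ?T (- \<i> * (Ln (- w) + \<i> * of_real pi))) holomorphic_on (uminus ` (- \<real>\<^sub>\<le>\<^sub>0))"
      by (intro holomorphic_on_compose_gen[OF _ holT, unfolded o_def] holomorphic_intros) auto
    fix w assume "w \<in> uminus ` (- \<real>\<^sub>\<le>\<^sub>0 :: complex set)"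
    then have "w \<noteq> 0" by auto
    then show "?T (- \<i> * (Ln (- w) + \<i> * of_real pi)) = H w"
      unfolding H_def by (intro expT) (simp add: exp_add)
  qed
  moreover have "open (uminus ` (- \<real>\<^sub>\<le>\<^sub>0 :: complex set))" "open (- \<real>\<^sub>\<le>\<^sub>0 :: complex set)"
    by (auto intro!: open_negations)
  ultimately have "H holomorphic_on (- \<real>\<^sub>\<le>\<^sub>0 \<union> uminus ` (- \<real>\<^sub>\<le>\<^sub>0))"
    by (intro holomorphic_on_Un) auto
  moreover have "- \<real>\<^sub>\<le>\<^sub>0 \<union> uminus ` (- \<real>\<^sub>\<le>\<^sub>0) = UNIV - {0::complex}"
  proof -
    have "w \<in> uminus ` (- \<real>\<^sub>\<le>\<^sub>0)" if "w \<noteq> 0" "w \<in> \<real>\<^sub>\<le>\<^sub>0" for w :: complex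
    proof -
      have "- w \<notin> \<real>\<^sub>\<le>\<^sub>0" using that by (auto simp: complex_nonpos_Reals_iff complex_eq_iff)
      then show ?thesis by (metis ComplI imageI minus_minus)
    qed
    then show ?thesis by auto
  qed
  ultimately have holH: "H holomorphic_on UNIV - {0}" by simp
  \<comment> \<open>Here w -> 0 means Im z -> +infinity, so \<open>upper\<close> yields the
    criterion for a removable singularity.\<close>
  have "((\<lambda>w. (w - 0) * H w) \<longlongrightarrow> 0) (at 0)"
  proof (rule Lim_null_comparison)
    have "filterlim (\<lambda>w::complex. - ln (norm w)) at_top (at 0)"
    proof -
      have "filterlim (\<lambda>w::complex. norm w) (at_right 0) (at 0)"
        by (auto simp: filterlim_at eventually_at_filter intro!: tendsto_eq_intros)
      then have "filterlim (\<lambda>w::complex. ln (norm w)) at_bot (at 0)"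
        by (rule filterlim_compose[OF ln_at_0])
      then show ?thesis by (simp add: filterlim_uminus_at_top)
    qed
    from filterlim_compose[OF upper this]
    show "((\<lambda>w. W (- ln (norm w)) * exp (- (- ln (norm w)))) \<longlongrightarrow> 0) (at (0::complex))" .
    show "eventually (\<lambda>w. norm ((w - 0) * H w) \<le> W (- ln (norm w)) * exp (- (- ln (norm w)))) (at 0)"
      using nH by (auto simp: eventually_at_filter norm_mult mult.commute intro!: always_eventually mult_left_mono)
  qed
  then obtain h where h: "h holomorphic_on UNIV" "\<And>w. w \<noteq> 0 \<Longrightarrow> h w = H w"
    using holomorphic_on_extend_lim[OF holH] by auto
  \<comment> \<open>Here w -> infinity means Im z -> -infinity, where \<open>lower\<close>
    applies.\<close>
  have "((\<lambda>w. h w / w ^ N) \<longlongrightarrow> 0) at_infinity"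
  proof (rule Lim_null_comparison)
    have "filterlim (\<lambda>w::complex. ln (norm w)) at_top at_infinity"
      by (rule filterlim_compose[OF ln_at_top filterlim_norm_at_top])
    from filterlim_compose[OF lower this]
    show "((\<lambda>w. W (- ln (norm w)) * exp (- (real N * ln (norm w)))) \<longlongrightarrow> 0) (at_infinity :: complex filter)" .
    show "eventually (\<lambda>w. norm (h w / w ^ N) \<le> W (- ln (norm w)) * exp (- (real N * ln (norm w)))) at_infinity"
      using eventually_not_equal_at_infinity[of "0::complex"]
    proof eventually_elim
      case (elim w)
      have "exp (real N * ln (norm w)) = norm w ^ N" using elim by (simp add: exp_of_nat_mult)
      then show ?case using nH[OF elim] elim h(2)[OF elim]
        by (simp add: norm_mult norm_inverse norm_power exp_minus divide_inverse mult_right_mono)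
    qed
  qed
  then obtain A where A: "\<And>w. h w = (\<Sum>j<N. A j * w ^ j)"
    using entire_eq_polynomial_if_little_o_power[OF h(1)] by metis
  have "?T z = (\<Sum>j<N. A j * exp (\<i> * z) ^ j)" for z
  proof -
    have "?T z = ?T (- \<i> * (\<i> * z))" by (simp flip: mult.assoc)
    also have "\<dots> = H (exp (\<i> * z))" unfolding H_def by (rule expT) simp
    finally show ?thesis using h(2)[of "exp (\<i> * z)"] A by simp
  qed
  then show ?thesis using that by blast
qed

end

section \<open>Integration against a periodic measure\<close>

lemma indicator_windows:
  fixes a x :: real
  shows "indicator {a..<a + 2*pi*real n} x = (\<Sum>j<n. indicator {0..<2*pi} (x - (a + 2*pi*real j)) :: real)"
proof (induction n)
  case (Suc n)
  define s where "s = 2*pi*real n"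
  have s: "s \<ge> 0" "2*pi*real (Suc n) = s + 2*pi" by (simp_all add: s_def algebra_simps)
  have "indicator {a..<a + 2*pi*real (Suc n)} x
      = indicator {a..<a + 2*pi*real n} x + (indicator {0..<2*pi} (x - (a + 2*pi*real n)) :: real)"
    unfolding s(2) s_def[symmetric] using s(1) pi_gt3 by (auto simp: indicator_def)
  then show ?case using Suc by simp
qed auto

abbreviation period_measure :: "real measure \<Rightarrow> real measure" where
  "period_measure \<mu> \<equiv> restrict_space \<mu> {0..<2*pi}"

context
  fixes \<mu> :: "real measure"
  assumes \<mu>: "periodic_sampling_measure \<mu>"
begin

lemma sets_mu [measurable_cong]: "sets \<mu> = sets borel" and space_mu: "space \<mu> = UNIV"
  using \<mu> sets_eq_imp_space_eq[of \<mu> borel] by (auto simp: periodic_sampling_measure_def)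

text \<open>Invariance is given for images of Borel sets. Applied to the preimage of
  \<open>A\<close> it becomes a statement on the push-forward, the form used for changes of
  variable.\<close>

lemma distr_shift_period: "distr \<mu> borel (\<lambda>x. x + 2*pi) = \<mu>"
proof (rule measure_eqI)
  fix A assume "A \<in> sets (distr \<mu> borel (\<lambda>x. x + 2*pi))"
  then have A: "A \<in> sets borel" by simp
  have v: "(\<lambda>x. x + 2*pi) -` A \<in> sets borel"
    using measurable_sets[of "\<lambda>x. x + 2*pi" borel borel A] A by simp
  have "(\<lambda>x. x + 2*pi) ` ((\<lambda>x. x + 2*pi) -` A) = A"
    by (auto intro!: image_eqI[of _ _ "_ - 2*pi"])
  then have "emeasure \<mu> ((\<lambda>x. x + 2*pi) -` A) = emeasure \<mu> A"
    using \<mu> v unfolding periodic_sampling_measure_def by metis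
  then show "emeasure (distr \<mu> borel (\<lambda>x. x + 2*pi)) A = emeasure \<mu> A"
    using A by (subst emeasure_distr) (auto simp: space_mu)
qed (simp add: sets_mu)

lemma distr_shift_periods: "distr \<mu> borel (\<lambda>x. x + 2*pi * of_int m) = \<mu>"
proof -
  have comp: "distr \<mu> borel (\<lambda>x. x + (c + d)) = \<mu>"
    if "distr \<mu> borel (\<lambda>x. x + c) = \<mu>" "distr \<mu> borel (\<lambda>x. x + d) = \<mu>" for c d
  proof -
    have "distr \<mu> borel (\<lambda>x. x + (c + d)) = distr (distr \<mu> borel (\<lambda>x. x + c)) borel (\<lambda>x. x + d)"
      by (subst distr_distr) (auto simp: o_def add.assoc)
    then show ?thesis using that by simp
  qed
  have uminus: "distr \<mu> borel (\<lambda>x. x + - c) = \<mu>" if c: "distr \<mu> borel (\<lambda>x. x + c) = \<mu>" for c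
  proof -
    have "distr \<mu> borel (\<lambda>x. x + - c) = distr (distr \<mu> borel (\<lambda>x. x + c)) borel (\<lambda>x. x + - c)"
      unfolding c ..
    also have "\<dots> = distr \<mu> borel (\<lambda>x. x)" by (subst distr_distr) (auto simp: o_def)
    also have "\<dots> = \<mu>" by (rule distr_id2) (simp add: sets_mu)
    finally show ?thesis .
  qed
  have nat: "distr \<mu> borel (\<lambda>x. x + 2*pi * real n) = \<mu>" for n
  proof (induction n)
    case 0
    then show ?case by (simp add: distr_id2 sets_mu)
  next
    case (Suc n)
    have "2*pi * real (Suc n) = 2*pi * real n + 2*pi" by (simp add: algebra_simps)
    then show ?case using comp[OF Suc distr_shift_period] by simp
  qed
  show ?thesis
  proof (cases m)
    case (nonneg n)
    then show ?thesis using nat[of n] by simp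
  next
    case (neg n)
    have "2*pi * of_int m = - (2*pi * real (Suc n))" unfolding neg by (simp add: algebra_simps)
    then show ?thesis using uminus[OF nat[of "Suc n"]] by metis
  qed
qed

lemma space_period_measure: "space (period_measure \<mu>) = {0..<2*pi}"
  by (simp add: space_restrict_space space_mu)

lemma finite_period_measure: "finite_measure (period_measure \<mu>)"
proof
  show "emeasure (period_measure \<mu>) (space (period_measure \<mu>)) \<noteq> \<infinity>"
    using \<mu> by (simp add: space_period_measure emeasure_restrict_space sets_mu space_mu periodic_sampling_measure_def less_top[symmetric])
qed

lemma measurable_period_measure:
  fixes h :: "real \<Rightarrow> 'a::{banach, second_countable_topology}"
  assumes "continuous_on UNIV h"
  shows "h \<in> borel_measurable (period_measure \<mu>)"
  by (rule measurable_restrict_space1) (use borel_measurable_continuous_onI[OF assms] in simp)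

lemma integrable_period_measure:
  fixes h :: "real \<Rightarrow> 'a::{banach, second_countable_topology}"
  assumes cont: "continuous_on UNIV h"
  shows "integrable (period_measure \<mu>) h"
proof -
  interpret finite_measure "period_measure \<mu>" by (rule finite_period_measure)
  have "compact (h ` {0..2*pi})" by (intro compact_continuous_image continuous_on_subset[OF cont]) auto
  then obtain B where "\<And>x. x \<in> {0..2*pi} \<Longrightarrow> norm (h x) \<le> B"
    using compact_imp_bounded bounded_iff by (metis imageI)
  then show ?thesis
    by (intro integrable_const_bound[of _ B] measurable_period_measure[OF cont])
      (auto simp: space_period_measure intro!: AE_I2)
qed

lemma integral_shift_window:
  fixes h :: "real \<Rightarrow> 'a::{banach, second_countable_topology}"
  assumes cont: "continuous_on UNIV h"
  shows "has_bochner_integral \<mu> (\<lambda>x. indicator {0..<2*pi} (x - 2*pi * of_int m) *\<^sub>R h x)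
    (LINT x|period_measure \<mu>. h (x + 2*pi * of_int m))"
proof -
  let ?c = "2*pi * of_int m"
  have meas [measurable]: "h \<in> borel_measurable borel" by (rule borel_measurable_continuous_onI[OF cont])
  have "continuous_on UNIV (\<lambda>x. h (x + ?c))" by (intro continuous_on_compose2[OF cont] continuous_intros) auto
  from integrable_period_measure[OF this]
  have int: "integrable \<mu> (\<lambda>x. indicator {0..<2*pi} x *\<^sub>R h (x + ?c))"
    by (simp add: integrable_restrict_space sets_mu space_mu)
  let ?g = "\<lambda>x. indicator {0..<2*pi} (x - ?c) *\<^sub>R h x"
  have gm: "?g \<in> borel_measurable borel" by measurable
  have "has_bochner_integral (distr \<mu> borel (\<lambda>x. x + ?c)) ?g (LINT x|period_measure \<mu>. h (x + ?c))"
    using int gm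
    by (simp add: has_bochner_integral_iff integrable_distr_eq integral_distr integral_restrict_space sets_mu space_mu)
  then show ?thesis by (simp add: distr_shift_periods)
qed

lemma integral_windows:
  fixes h :: "real \<Rightarrow> 'a::{banach, second_countable_topology}"
  assumes cont: "continuous_on UNIV h"
  shows "has_bochner_integral \<mu> (\<lambda>x. indicator {- (2*pi*real k)..<2*pi*real k} x *\<^sub>R h x)
    (LINT x|period_measure \<mu>. (\<Sum>i<k. h (x + 2*pi*real i) + h (x - 2*pi*real (Suc i))))"
proof -
  have c: "2*pi * of_int (int j - int k) = - (2*pi*real k) + 2*pi*real j" for j by (simp add: algebra_simps)
  have "has_bochner_integral \<mu> (\<lambda>x. \<Sum>j<2*k. indicator {0..<2*pi} (x - 2*pi * of_int (int j - int k)) *\<^sub>R h x)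
      (\<Sum>j<2*k. LINT x|period_measure \<mu>. h (x + 2*pi * of_int (int j - int k)))"
    by (intro has_bochner_integral_sum integral_shift_window cont)
  moreover have "(\<Sum>j<2*k. indicator {0..<2*pi} (x - 2*pi * of_int (int j - int k)) *\<^sub>R h x)
      = indicator {- (2*pi*real k)..<2*pi*real k} x *\<^sub>R h x" for x
    unfolding c scaleR_left.sum[symmetric] indicator_windows[symmetric] by (simp add: mult.assoc)
  moreover have "(\<Sum>j<2*k. LINT x|period_measure \<mu>. h (x + 2*pi * of_int (int j - int k)))
      = (LINT x|period_measure \<mu>. (\<Sum>j<2*k. h (x + 2*pi * of_int (int j - int k))))"
    by (rule Bochner_Integration.integral_sum[symmetric])
      (intro integrable_period_measure continuous_on_compose2[OF cont] continuous_intros, auto)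
  moreover have "(\<Sum>j<2*k. h (x + 2*pi * of_int (int j - int k)))
      = (\<Sum>i<k. h (x + 2*pi*real i) + h (x - 2*pi*real (Suc i)))" for x
    using symmetric_window_sum[of h x k] by (simp add: algebra_simps)
  ultimately show ?thesis by simp
qed

text \<open>Monotone convergence over growing windows makes \<open>h\<close> integrable, since each
  window integral unfolds to one over a period bounded by \<open>B\<close>. Dominated convergence,
  by |h| on the line and by \<open>B\<close> on the finite period measure, then identifies the two
  limits.\<close>

lemma integral_periodization:
  fixes h :: "real \<Rightarrow> complex"
  assumes cont: "continuous_on UNIV h"
    and bound: "\<And>x k. (\<Sum>i<k. norm (h (x + 2*pi*real i)) + norm (h (x - 2*pi*real (Suc i)))) \<le> B"
    and sums: "\<And>x. (\<lambda>i. h (x + 2*pi*real i) + h (x - 2*pi*real (Suc i))) sums T x"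
  shows "integrable \<mu> h" "(LINT x|\<mu>. h x) = (LINT x|period_measure \<mu>. T x)"
proof -
  interpret finite_measure "period_measure \<mu>" by (rule finite_period_measure)
  let ?A = "\<lambda>k. {- (2*pi*real k)..<2*pi*real k}"
  have meas: "h \<in> borel_measurable \<mu>" using borel_measurable_continuous_onI[OF cont] by simp
  have contn: "continuous_on UNIV (\<lambda>x. norm (h x))" by (intro continuous_intros cont)
  have ind: "(\<lambda>k. indicator (?A k) x *\<^sub>R g x) \<longlonglongrightarrow> g x" for g :: "real \<Rightarrow> 'b::real_normed_vector" and x
  proof (rule tendsto_eventually)
    obtain k0 :: nat where k0: "\<bar>x\<bar> < real k0" using reals_Archimedean2 by blast
    show "eventually (\<lambda>k. indicator (?A k) x *\<^sub>R g x = g x) sequentially"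
      using eventually_ge_at_top[of k0]
    proof eventually_elim
      case (elim k)
      have "real k * 1 \<le> real k * (2*pi)" using pi_gt3 by (intro mult_left_mono) auto
      then have "\<bar>x\<bar> < 2*pi*real k" using k0 elim by (simp add: mult.commute)
      then show ?case by (auto simp: indicator_def abs_if split: if_splits)
    qed
  qed
  let ?I = "\<lambda>k. LINT x|\<mu>. indicator (?A k) x *\<^sub>R norm (h x)"
  have intk: "integrable \<mu> (\<lambda>x. indicator (?A k) x *\<^sub>R norm (h x))" for k
    using integral_windows[OF contn] by (simp add: has_bochner_integral_iff)
  have Ik: "?I k = (LINT x|period_measure \<mu>. (\<Sum>i<k. norm (h (x + 2*pi*real i)) + norm (h (x - 2*pi*real (Suc i)))))" for k
    using integral_windows[OF contn] by (simp add: has_bochner_integral_iff)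
  have "?I k \<le> (LINT x|period_measure \<mu>. B)" for k
    unfolding Ik
    by (intro integral_mono bound integrable_const integrable_period_measure continuous_intros
        continuous_on_compose2[OF cont]) auto
  moreover have mono: "mono (\<lambda>k. indicator (?A k) x *\<^sub>R norm (h x))" for x
  proof (rule monoI)
    fix k l :: nat assume "k \<le> l"
    then have le: "2*pi*real k \<le> 2*pi*real l" by simp
    have "indicator {-a..<a} x *\<^sub>R norm (h x) \<le> indicator {-b..<b} x *\<^sub>R norm (h x)" if "a \<le> b" for a b
      using that by (auto simp: indicator_def)
    from this[OF le] show "indicator (?A k) x *\<^sub>R norm (h x) \<le> indicator (?A l) x *\<^sub>R norm (h x)" .
  qed
  moreover have "incseq ?I" by (intro monoI integral_mono intk monoD[OF mono])
  ultimately obtain L where L: "?I \<longlonglongrightarrow> L" using incseq_convergent[of ?I] by metis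
  have "integrable \<mu> (\<lambda>x. norm (h x))"
  proof (rule integrable_monotone_convergence[OF intk _ _ L])
    show "AE x in \<mu>. mono (\<lambda>k. indicator (?A k) x *\<^sub>R norm (h x))" by (intro AE_I2 mono)
    show "AE x in \<mu>. (\<lambda>k. indicator (?A k) x *\<^sub>R norm (h x)) \<longlonglongrightarrow> norm (h x)" by (intro AE_I2 ind)
  qed (use meas in auto)
  then show int: "integrable \<mu> h" using meas by (simp add: integrable_norm_iff)
  have 1: "(\<lambda>k. LINT x|\<mu>. indicator (?A k) x *\<^sub>R h x) \<longlonglongrightarrow> (LINT x|\<mu>. h x)"
    by (rule integral_dominated_convergence[where w = "\<lambda>x. norm (h x)"])
      (use int ind meas in \<open>auto simp: indicator_def sets_mu\<close>)
  let ?P = "\<lambda>k x. (\<Sum>i<k. h (x + 2*pi*real i) + h (x - 2*pi*real (Suc i)))"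
  have Pm: "?P k \<in> borel_measurable (period_measure \<mu>)" for k
    by (intro measurable_period_measure continuous_intros continuous_on_compose2[OF cont]) auto
  have lim: "(\<lambda>k. ?P k x) \<longlonglongrightarrow> T x" for x using sums by (simp add: sums_def)
  have Tm: "T \<in> borel_measurable (period_measure \<mu>)" by (rule borel_measurable_LIMSEQ_metric[OF Pm lim])
  have "(\<lambda>k. LINT x|period_measure \<mu>. ?P k x) \<longlonglongrightarrow> (LINT x|period_measure \<mu>. T x)"
  proof (rule integral_dominated_convergence[where w = "\<lambda>x. B"])
    show "AE x in period_measure \<mu>. norm (?P k x) \<le> B" for k
      by (intro AE_I2 order_trans[OF sum_norm_le[OF norm_triangle_ineq] bound])
  qed (use lim Pm Tm in auto)
  moreover have "(LINT x|period_measure \<mu>. ?P k x) = (LINT x|\<mu>. indicator (?A k) x *\<^sub>R h x)" for k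
    using integral_windows[OF cont, of k] by (simp add: has_bochner_integral_iff)
  ultimately show "(LINT x|\<mu>. h x) = (LINT x|period_measure \<mu>. T x)" using 1 LIMSEQ_unique by auto
qed

lemma vanishing_on_support:
  fixes h :: "real \<Rightarrow> complex"
  assumes cont: "continuous_on UNIV h" and null: "(LINT x|period_measure \<mu>. (norm (h x))\<^sup>2) = 0"
    and x: "x \<in> restr_support \<mu> {0..<2*pi}"
  shows "h x = 0"
proof (rule ccontr)
  assume "h x \<noteq> 0"
  then obtain e where e: "e > 0" "\<And>y. dist y x < e \<Longrightarrow> h y \<noteq> 0"
    using continuous_at_avoid[of x h 0] cont by (auto simp: continuous_on_eq_continuous_at dist_commute)
  have "AE y in period_measure \<mu>. (norm (h y))\<^sup>2 = 0"
    using null by (subst (asm) integral_nonneg_eq_0_iff_AE)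
      (auto intro!: integrable_period_measure continuous_intros cont)
  then have "AE y in \<mu>. y \<in> {0..<2*pi} \<longrightarrow> h y = 0"
    by (simp add: AE_restrict_space_iff sets_mu space_mu)
  then have "AE y in \<mu>. y \<notin> ball x e \<inter> {0..<2*pi}"
    by (rule AE_mp) (use e in \<open>auto simp: dist_commute intro!: AE_I2\<close>)
  then have "emeasure \<mu> (ball x e \<inter> {0..<2*pi}) = 0"
    by (subst (asm) AE_iff_measurable[where N = "ball x e \<inter> {0..<2*pi}"]) (auto simp: sets_mu space_mu)
  moreover have "emeasure \<mu> (ball x e \<inter> {0..<2*pi}) > 0" using x e by (simp add: restr_support_def)
  ultimately show False by simp
qed

text \<open>A null square integral forces zeros on the whole support by continuity. The support is
  infinite and bounded, so it has a limit point and the identity theorem applies.\<close>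

lemma entire_vanishing_on_support:
  assumes hol: "g holomorphic_on UNIV" and null: "(LINT x|period_measure \<mu>. (norm (g (of_real x)))\<^sup>2) = 0"
  shows "g z = 0"
proof -
  let ?S = "restr_support \<mu> {0..<2*pi}"
  have "continuous_on UNIV (\<lambda>x::real. g (of_real x))"
    by (intro continuous_on_compose2[OF holomorphic_on_imp_continuous_on[OF hol]] continuous_intros) auto
  then have zero: "g (of_real x) = 0" if "x \<in> ?S" for x
    using vanishing_on_support[OF _ null that] by blast
  \<comment> \<open>The right endpoint is included: mass accumulating at 2 pi from the left puts it
    in the support although the window is half-open.\<close>
  have sub: "?S \<subseteq> {0..2*pi}"
  proof
    fix x assume x: "x \<in> ?S"
    show "x \<in> {0..2*pi}"
    proof (rule ccontr)
      assume "x \<notin> {0..2*pi}"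
      then obtain e where "e > 0" "ball x e \<subseteq> - {0..2*pi}"
        using open_contains_ball[of "- {0..2*pi}"] open_Compl[OF closed_atLeastAtMost] by blast
      then have "ball x e \<inter> {0..<2*pi} = {}" by fastforce
      then show False using x \<open>e > 0\<close> by (auto simp: restr_support_def dest!: spec[of _ e])
    qed
  qed
  have inf: "infinite ((of_real :: real \<Rightarrow> complex) ` ?S)"
    using \<mu> by (auto simp: periodic_sampling_measure_def finite_image_iff inj_on_def)
  have "bounded ((of_real :: real \<Rightarrow> complex) ` ?S)"
    by (rule boundedI[of _ "2*pi"]) (use sub in auto)
  then obtain \<xi> where \<xi>: "\<xi> islimpt ((of_real :: real \<Rightarrow> complex) ` ?S)"
    using bounded_infinite_imp_islimpt[OF order_refl _ inf] by blast
  show ?thesis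
    by (rule analytic_continuation[OF hol open_UNIV connected_UNIV _ _ \<xi>]) (use zero in auto)
qed

end

section \<open>The reproducing formula\<close>

lemma PW_cmult: "f \<in> PW t \<Longrightarrow> (\<lambda>z. c * f z) \<in> PW t"
  by (auto simp: mem_PW_iff norm_mult power_mult_distrib intro: entire_of_type_cmult)

lemma PW_continuous:
  assumes "f \<in> PW t"
  shows "continuous_on UNIV (\<lambda>x::real. f (of_real x))"
proof -
  have hol: "f holomorphic_on UNIV" using assms by (simp add: mem_PW_iff entire_of_type_def)
  show ?thesis
    by (intro continuous_on_compose2[OF holomorphic_on_imp_continuous_on[OF hol]] continuous_intros) auto
qed

lemma PW_add:
  assumes f: "f \<in> PW t" and g: "g \<in> PW t"
  shows "(\<lambda>z. f z + g z) \<in> PW t"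
  unfolding mem_PW_iff
proof
  show "entire_of_type t (\<lambda>z. f z + g z)" using f g by (auto simp: mem_PW_iff intro: entire_of_type_add)
  have "continuous_on UNIV (\<lambda>x::real. (norm (f (of_real x) + g (of_real x)))\<^sup>2)"
    by (intro continuous_intros PW_continuous[OF f] PW_continuous[OF g])
  then have meas: "(\<lambda>x::real. (norm (f (of_real x) + g (of_real x)))\<^sup>2) \<in> borel_measurable lborel"
    using borel_measurable_continuous_onI by simp
  show "integrable lborel (\<lambda>x::real. (norm (f (of_real x) + g (of_real x)))\<^sup>2)"
  proof (rule Bochner_Integration.integrable_bound[OF _ meas])
    show "integrable lborel (\<lambda>x::real. 2 * (norm (f (of_real x)))\<^sup>2 + 2 * (norm (g (of_real x)))\<^sup>2)"
      using f g by (intro Bochner_Integration.integrable_add integrable_mult_right) (auto simp: mem_PW_iff)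
    have "(norm (a + b))\<^sup>2 \<le> 2 * (norm a)\<^sup>2 + 2 * (norm b)\<^sup>2" for a b :: complex
    proof -
      have "(norm (a + b))\<^sup>2 \<le> (norm a + norm b)\<^sup>2" by (intro power_mono norm_triangle_ineq) auto
      also have "\<dots> \<le> 2 * (norm a)\<^sup>2 + 2 * (norm b)\<^sup>2"
        using sum_squares_bound[of "norm a" "norm b"] by (simp add: power2_sum)
      finally show ?thesis .
    qed
    then show "AE x in lborel. norm ((norm (f (of_real x) + g (of_real x)))\<^sup>2)
        \<le> norm (2 * (norm (f (of_real x)))\<^sup>2 + 2 * (norm (g (of_real x)))\<^sup>2)"
      by (intro AE_I2) simp
  qed
qed

lemma PW_0: "(\<lambda>z. 0) \<in> PW t"
  by (simp add: mem_PW_iff entire_of_type_0)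

lemma PW_sum: "(\<And>i. i \<in> I \<Longrightarrow> f i \<in> PW t) \<Longrightarrow> (\<lambda>z. \<Sum>i\<in>I. f i z) \<in> PW t"
  by (induction I rule: infinite_finite_induct) (auto intro: PW_0 PW_add)

lemma PW_diff: "f \<in> PW t \<Longrightarrow> g \<in> PW t \<Longrightarrow> (\<lambda>z. f z - g z) \<in> PW t"
  using PW_add[of f t "\<lambda>z. (-1) * g z"] PW_cmult[of g t "-1"] by simp

text \<open>On the real axis this is complex conjugation, and it keeps the function entire; it
  recovers the kernel from its conjugate.\<close>

lemma PW_reflect:
  assumes "f \<in> PW t"
  shows "(\<lambda>z. cnj (f (cnj z))) \<in> PW t"
  unfolding mem_PW_iff entire_of_type_def
proof (intro conjI allI impI)
  show "(\<lambda>z. cnj (f (cnj z))) holomorphic_on UNIV"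
    using holomorphic_on_compose_cnj_cnj[of f UNIV] assms holomorphic_on_subset[of f UNIV]
    by (simp add: mem_PW_iff entire_of_type_def o_def)
  fix e :: real assume "e > 0"
  then obtain C where "\<And>z. norm (f z) \<le> C * exp ((t + e) * norm z)"
    using assms by (auto simp: mem_PW_iff entire_of_type_def)
  then show "\<exists>C. \<forall>z. norm (cnj (f (cnj z))) \<le> C * exp ((t + e) * norm z)" by (metis complex_mod_cnj)
qed (use assms in \<open>simp add: mem_PW_iff\<close>)

section \<open>Modulated windows and their periodizations\<close>

lemma integrable_inverse_one_plus_square: "integrable lborel (\<lambda>x::real. 8 / (1 + x\<^sup>2))"
proof -
  have "set_integrable lborel (einterval (-\<infinity>) \<infinity>) (\<lambda>x::real. inverse (1 + x\<^sup>2))"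
    by (rule integrable_inverse_1_plus_square)
  then have "integrable lborel (\<lambda>x::real. inverse (1 + x\<^sup>2))"
    by (simp add: set_integrable_def einterval_def)
  from integrable_mult_right[OF this, of 8] show ?thesis by (simp add: divide_inverse)
qed

text \<open>The modulation translates the frequency window by \<open>l\<close>, and the translated
  window still lies in [-t, t]. Square integrability comes from
  \<open>norm_window_ft_square_le\<close>.\<close>

lemma modulated_window_ft_in_PW:
  assumes ab: "\<alpha> \<le> \<beta>" "\<beta> \<le> \<alpha> + 1" and t: "- t \<le> \<alpha> + real l" "\<beta> + real l \<le> t"
  shows "(\<lambda>z. exp (- (\<i> * of_nat l * z)) * window_ft \<alpha> \<beta> z) \<in> PW t"
proof -
  let ?g = "\<lambda>z. exp (- (\<i> * of_nat l * z)) * window_ft \<alpha> \<beta> z"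
  have hol: "?g holomorphic_on UNIV" by (intro holomorphic_intros window_ft_holomorphic)
  have t0: "t \<ge> 0" using ab t by linarith
  have ng: "norm (?g z) \<le> exp (t * norm z)" for z
  proof -
    define y where "y = Im z"
    have mx: "real l * y + max (\<alpha> * y) (\<beta> * y) \<le> t * norm z"
    proof -
      have "\<gamma> * y + real l * y \<le> t * norm z" if "- t \<le> \<gamma> + real l" "\<gamma> + real l \<le> t" for \<gamma>
      proof -
        have "(\<gamma> + real l) * y \<le> \<bar>\<gamma> + real l\<bar> * \<bar>y\<bar>" by (metis abs_ge_self abs_mult)
        also have "\<dots> \<le> t * norm z" using that t0 abs_Im_le_cmod[of z] by (intro mult_mono) (auto simp: y_def)
        finally show ?thesis by (simp add: algebra_simps)
      qed
      from this[of \<alpha>] this[of \<beta>] show ?thesis using ab t by (auto simp: max_def)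
    qed
    have "norm (?g z) = exp (real l * y) * norm (window_ft \<alpha> \<beta> z)"
      by (simp add: norm_mult y_def)
    also have "\<dots> \<le> exp (real l * y) * (exp (max (\<alpha> * y) (\<beta> * y)) * (\<beta> - \<alpha>))"
      unfolding y_def by (intro mult_left_mono norm_window_ft_le ab) auto
    also have "\<dots> \<le> exp (real l * y) * (exp (max (\<alpha> * y) (\<beta> * y)) * 1)"
      using ab by (intro mult_left_mono) auto
    also have "\<dots> \<le> exp (t * norm z)" using mx by (simp flip: exp_add)
    finally show ?thesis .
  qed
  have "entire_of_type t ?g"
    unfolding entire_of_type_def
  proof (intro conjI allI impI hol)
    fix e :: real assume "e > 0"
    then have "norm (?g z) \<le> 1 * exp ((t + e) * norm z)" for z
      using ng[of z] by (elim order_trans) (simp add: distrib_right)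
    then show "\<exists>C. \<forall>z. norm (?g z) \<le> C * exp ((t + e) * norm z)" by blast
  qed
  moreover have "integrable lborel (\<lambda>x::real. (norm (?g (of_real x)))\<^sup>2)"
  proof (rule Bochner_Integration.integrable_bound[OF integrable_inverse_one_plus_square])
    have "continuous_on UNIV (\<lambda>x::real. (norm (?g (of_real x)))\<^sup>2)"
      by (intro continuous_intros continuous_on_compose2[OF holomorphic_on_imp_continuous_on[OF window_ft_holomorphic]]) auto
    then show "(\<lambda>x::real. (norm (?g (of_real x)))\<^sup>2) \<in> borel_measurable lborel"
      using borel_measurable_continuous_onI by simp
    show "AE x in lborel. norm ((norm (?g (of_real x)))\<^sup>2) \<le> norm (8 / (1 + x\<^sup>2))"
      using norm_window_ft_square_le[OF ab, of "of_real _"] by (intro AE_I2) (simp add: norm_mult)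
  qed
  ultimately show ?thesis by (simp add: mem_PW_iff)
qed

lemma exp_modulation_period:
  "exp (- (\<i> * of_nat l * (z + of_real (2*pi*real i)))) = exp (- (\<i> * of_nat l * z))"
  "exp (- (\<i> * of_nat l * (z - of_real (2*pi*real i)))) = exp (- (\<i> * of_nat l * z))"
proof -
  have "- (\<i> * of_nat l * (z + of_real (2*pi*real i))) = - (\<i> * of_nat l * z) + \<i> * (of_int (- int (l * i)) * (of_real pi * 2))"
    "- (\<i> * of_nat l * (z - of_real (2*pi*real i))) = - (\<i> * of_nat l * z) + \<i> * (of_int (int (l * i)) * (of_real pi * 2))"
    by (simp_all add: algebra_simps)
  then show "exp (- (\<i> * of_nat l * (z + of_real (2*pi*real i)))) = exp (- (\<i> * of_nat l * z))"
    "exp (- (\<i> * of_nat l * (z - of_real (2*pi*real i)))) = exp (- (\<i> * of_nat l * z))"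
    by (simp_all only: exp_add exp_2pi_1_int mult_1_right)
qed

text \<open>With y = Im z, the sums grow at most like exp ((t + \<open>\<beta>\<close>) y) upwards
  and exp ((t - \<open>\<alpha>\<close>) |y|) downwards. The two hypotheses therefore confine the
  exponents to 0, ..., N - 1; equality is admissible thanks to the extra root decay.\<close>

lemma PW_window_periodization:
  assumes f: "f \<in> PW t" and t: "t \<ge> 0" and ab: "\<alpha> \<le> \<beta>" "\<beta> \<le> \<alpha> + 1"
    and upper: "t + \<beta> \<le> 1" and lower: "t - \<alpha> \<le> real N"
  obtains W A where "\<And>z k. (\<Sum>j<k. norm (f (z + of_real (2*pi*real j)) * window_ft \<alpha> \<beta> (z + of_real (2*pi*real j)))) \<le> W (Im z)"
    "\<And>z. periodization (\<lambda>z. f z * window_ft \<alpha> \<beta> z) z = (\<Sum>j<N. A j * exp (\<i> * z) ^ j)"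
proof -
  obtain D where D: "D > 0" and sumD:
    "\<And>z k. (\<Sum>j<k. norm (f (z + of_real (2*pi*real j)) * window_ft \<alpha> \<beta> (z + of_real (2*pi*real j))))
       \<le> D * exp (t * \<bar>Im z\<bar> + max (\<alpha> * Im z) (\<beta> * Im z)) / sqrt (sqrt (1 + (Im z)\<^sup>2))"
    using PW_window_sum_bound[OF f t ab] by blast
  define W where "W y = D * exp (t * \<bar>y\<bar> + max (\<alpha> * y) (\<beta> * y)) / sqrt (sqrt (1 + y\<^sup>2))" for y
  have W: "\<And>z k. (\<Sum>j<k. norm (f (z + of_real (2*pi*real j)) * window_ft \<alpha> \<beta> (z + of_real (2*pi*real j)))) \<le> W (Im z)"
    using sumD by (simp add: W_def)
  have hol: "(\<lambda>z. f z * window_ft \<alpha> \<beta> z) holomorphic_on UNIV"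
    using f by (intro holomorphic_intros window_ft_holomorphic) (simp add: mem_PW_iff entire_of_type_def)
  have contW: "continuous_on UNIV W"
    unfolding W_def by (intro continuous_intros) (auto simp: add_nonneg_eq_0_iff)
  have decay: "((\<lambda>y::real. D / sqrt (sqrt (1 + y\<^sup>2))) \<longlongrightarrow> 0) at_top" by real_asymp
  have le: "norm (D * exp a / sqrt (sqrt (1 + y\<^sup>2)) * exp b) \<le> D / sqrt (sqrt (1 + y\<^sup>2))" if "a + b \<le> 0" for a b y
  proof -
    have "exp a * exp b \<le> 1" using that by (simp flip: exp_add)
    then have "D * (exp a * exp b) \<le> D * 1" using D by (intro mult_left_mono) auto
    then show ?thesis using D by (simp add: abs_mult mult.assoc divide_right_mono)
  qed
  have "((\<lambda>y. W y * exp (- y)) \<longlongrightarrow> 0) at_top"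
  proof (rule Lim_null_comparison[OF _ decay])
    show "eventually (\<lambda>y. norm (W y * exp (- y)) \<le> D / sqrt (sqrt (1 + y\<^sup>2))) at_top"
      using eventually_ge_at_top[of 0]
    proof eventually_elim
      case (elim y)
      have "max (\<alpha> * y) (\<beta> * y) = \<beta> * y" using elim ab by (simp add: max_def mult_right_mono)
      moreover have "(t + \<beta>) * y \<le> 1 * y" using elim upper by (intro mult_right_mono)
      ultimately show ?case unfolding W_def using elim by (intro le) (simp add: algebra_simps)
    qed
  qed
  moreover have "((\<lambda>y. W (- y) * exp (- (real N * y))) \<longlongrightarrow> 0) at_top"
  proof (rule Lim_null_comparison[OF _ decay])
    show "eventually (\<lambda>y. norm (W (- y) * exp (- (real N * y))) \<le> D / sqrt (sqrt (1 + y\<^sup>2))) at_top"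
      using eventually_ge_at_top[of 0]
    proof eventually_elim
      case (elim y)
      have "\<alpha> * y \<le> \<beta> * y" using elim ab by (intro mult_right_mono)
      then have "max (\<alpha> * - y) (\<beta> * - y) = - (\<alpha> * y)" by (simp add: max_def)
      moreover have "(t - \<alpha>) * y \<le> real N * y" using elim lower by (intro mult_right_mono)
      ultimately show ?case unfolding W_def power2_minus using elim by (intro le) (simp add: algebra_simps)
    qed
  qed
  ultimately obtain A where "\<And>z. periodization (\<lambda>z. f z * window_ft \<alpha> \<beta> z) z = (\<Sum>j<N. A j * exp (\<i> * z) ^ j)"
    using periodization_eq_trig_polynomial[OF hol W contW] by blast
  then show ?thesis using that W by blast
qed

text \<open>The two windows join to a unit window, whose transform is 1 at 0 and vanishes at every
  other point of 2 pi Z.\<close>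

lemma periodization_split_unit_window:
  assumes f: "f \<in> PW t" and t: "t \<ge> 0" and b: "\<alpha> \<le> \<beta>" "\<beta> \<le> \<alpha> + 1"
  shows "periodization (\<lambda>z. f z * window_ft \<alpha> \<beta> z) 0 + periodization (\<lambda>z. f z * window_ft \<beta> (\<alpha> + 1) z) 0 = f 0"
proof -
  have hol: "(\<lambda>z. f z * window_ft \<gamma> \<delta> z) holomorphic_on UNIV" for \<gamma> \<delta>
    using f by (intro holomorphic_intros window_ft_holomorphic) (simp add: mem_PW_iff entire_of_type_def)
  have sums: "(\<lambda>i. f (0 + of_real (2*pi*real i)) * window_ft \<gamma> \<delta> (0 + of_real (2*pi*real i))
      + f (0 - of_real (2*pi*real (Suc i))) * window_ft \<gamma> \<delta> (0 - of_real (2*pi*real (Suc i))))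
      sums periodization (\<lambda>z. f z * window_ft \<gamma> \<delta> z) 0" if cd: "\<gamma> \<le> \<delta>" "\<delta> \<le> \<gamma> + 1" for \<gamma> \<delta>
  proof -
    obtain D where "D > 0" and D: "\<And>z k. (\<Sum>j<k. norm (f (z + of_real (2*pi*real j)) * window_ft \<gamma> \<delta> (z + of_real (2*pi*real j))))
       \<le> D * exp (t * \<bar>Im z\<bar> + max (\<gamma> * Im z) (\<delta> * Im z)) / sqrt (sqrt (1 + (Im z)\<^sup>2))"
      using PW_window_sum_bound[OF f t cd] by blast
    define W where "W y = D * exp (t * \<bar>y\<bar> + max (\<gamma> * y) (\<delta> * y)) / sqrt (sqrt (1 + y\<^sup>2))" for y
    have "\<And>z k. (\<Sum>j<k. norm (f (z + of_real (2*pi*real j)) * window_ft \<gamma> \<delta> (z + of_real (2*pi*real j)))) \<le> W (Im z)"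
      using D by (simp add: W_def)
    from periodization_sums[OF hol this, of 0] show ?thesis .
  qed
  have win: "window_ft \<alpha> \<beta> z + window_ft \<beta> (\<alpha> + 1) z = window_ft \<alpha> (\<alpha> + 1) z" for z
    by (rule window_ft_combine[OF b])
  have pos: "window_ft \<alpha> (\<alpha> + 1) (of_real (2*pi*real i)) = (if i = 0 then 1 else 0)" for i
    using window_ft_unit_period[of "int i" \<alpha>] by (auto simp: window_ft_0)
  have neg: "window_ft \<alpha> (\<alpha> + 1) (- of_real (2*pi*real (Suc i))) = 0" for i
  proof -
    have eq: "- of_real (2*pi*real (Suc i)) = (of_real (2*pi * of_int (- int (Suc i))) :: complex)"
      by (simp add: algebra_simps)
    show ?thesis unfolding eq by (rule window_ft_unit_period) simp
  qed
  have "(\<lambda>i. f (of_real (2*pi*real i)) * window_ft \<alpha> (\<alpha> + 1) (of_real (2*pi*real i))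
      + f (- of_real (2*pi*real (Suc i))) * window_ft \<alpha> (\<alpha> + 1) (- of_real (2*pi*real (Suc i))))
      sums (periodization (\<lambda>z. f z * window_ft \<alpha> \<beta> z) 0 + periodization (\<lambda>z. f z * window_ft \<beta> (\<alpha> + 1) z) 0)"
    using sums_add[OF sums[OF b] sums[of \<beta> "\<alpha> + 1"]] b unfolding win[symmetric] by (simp add: algebra_simps)
  then have "(\<lambda>i. if i = 0 then f 0 else 0) sums
      (periodization (\<lambda>z. f z * window_ft \<alpha> \<beta> z) 0 + periodization (\<lambda>z. f z * window_ft \<beta> (\<alpha> + 1) z) 0)"
    unfolding pos neg by (rule sums_cong[THEN iffD1, rotated]) auto
  moreover have "(\<lambda>i. if i = 0 then f 0 else 0) sums f 0" using sums_single[of 0 "\<lambda>_. f 0"] by simp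
  ultimately show ?thesis using sums_unique2 by blast
qed

section \<open>Pairings with respect to \<open>\<mu>\<close> and uniqueness of the kernel\<close>

context
  fixes \<mu> :: "real measure"
  assumes \<mu>: "periodic_sampling_measure \<mu>"
begin

lemma integral_exp_period_measure:
  "(LINT x|period_measure \<mu>. exp (- (\<i> * of_nat l * of_real x)) * exp (\<i> * of_real x) ^ j) = 2 * pi * moment \<mu> (int l - int j)"
proof -
  have "exp (- (\<i> * of_nat l * of_real x)) * exp (\<i> * of_real x) ^ j = cis (- (of_int (int l - int j) * x))" for x
    by (simp add: cis_conv_exp algebra_simps flip: exp_add exp_of_nat_mult)
  then show ?thesis by (simp add: moment_def)
qed

lemma moment_cnj: "cnj (moment \<mu> k) = moment \<mu> (- k)"
proof -
  have "cnj (LINT x|period_measure \<mu>. cis (- (of_int k * x))) = (LINT x|period_measure \<mu>. cis (- (of_int (- k) * x)))"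
    by (subst Bochner_Integration.integral_cnj[symmetric]) (simp add: cis_cnj)
  then show ?thesis by (simp add: moment_def)
qed

text \<open>The sampling sums of |f|^2 are bounded uniformly, so the integral unfolds to one over
  the finite period measure.\<close>

lemma PW_square_integrable:
  assumes f: "f \<in> PW t" and t: "t \<ge> 0"
  shows "integrable \<mu> (\<lambda>x. (norm (f (of_real x)))\<^sup>2)"
proof -
  obtain S where "S > 0" and S: "\<And>(x::real) k. (\<Sum>j<k. (norm (f (of_real (x + 2*pi*real j))))\<^sup>2) \<le> S"
    using PW_real_sample_bound[OF f t] by blast
  define h where "h x = complex_of_real ((norm (f (of_real x)))\<^sup>2)" for x :: real
  have cont: "continuous_on UNIV h" unfolding h_def[abs_def] by (intro continuous_intros PW_continuous[OF f])
  have bound: "(\<Sum>i<k. norm (h (x + 2*pi*real i)) + norm (h (x - 2*pi*real (Suc i)))) \<le> S" for x k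
  proof -
    have "(\<Sum>i<k. norm (h (x + 2*pi*real i)) + norm (h (x - 2*pi*real (Suc i))))
        = (\<Sum>j<2*k. norm (h (x - 2*pi*real k + 2*pi*real j)))"
      using symmetric_window_sum[of "\<lambda>x. norm (h x)" x k] by (simp only: of_real_eq_id id_apply)
    also have "\<dots> \<le> S"
      using S[where x = "x - 2*pi*real k" and k = "2*k"] by (simp only: h_def norm_of_real abs_power2)
    finally show ?thesis .
  qed
  have "(\<lambda>i. h (x + 2*pi*real i) + h (x - 2*pi*real (Suc i))) sums (\<Sum>i. h (x + 2*pi*real i) + h (x - 2*pi*real (Suc i)))" for x
  proof (rule summable_sums)
    have "summable (\<lambda>i. norm (h (x + 2*pi*real i)) + norm (h (x - 2*pi*real (Suc i))))"
      by (rule summableI_nonneg_bounded[OF _ bound]) auto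
    then show "summable (\<lambda>i. h (x + 2*pi*real i) + h (x - 2*pi*real (Suc i)))"
      by (rule summable_comparison_test') (rule norm_triangle_ineq)
  qed
  from integral_periodization(1)[OF \<mu> cont bound this]
  have "integrable \<mu> (\<lambda>x. norm (h x))" by simp
  then show ?thesis by (simp add: h_def norm_power)
qed

lemma PW_product_integrable:
  assumes f: "f \<in> PW t" and g: "g \<in> PW t" and t: "t \<ge> 0"
  shows "integrable \<mu> (\<lambda>x. f (of_real x) * cnj (g (of_real x)))"
proof (rule Bochner_Integration.integrable_bound)
  show "integrable \<mu> (\<lambda>x. 1 / 2 * (norm (f (of_real x)))\<^sup>2 + 1 / 2 * (norm (g (of_real x)))\<^sup>2)"
    by (intro Bochner_Integration.integrable_add integrable_mult_right PW_square_integrable[OF _ t] f g)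
  have "continuous_on UNIV (\<lambda>x::real. f (of_real x) * cnj (g (of_real x)))"
    by (intro continuous_intros PW_continuous[OF f] PW_continuous[OF g])
  then show "(\<lambda>x::real. f (of_real x) * cnj (g (of_real x))) \<in> borel_measurable \<mu>"
    using borel_measurable_continuous_onI sets_mu[OF \<mu>] by (simp cong: measurable_cong_sets)
  show "AE x in \<mu>. norm (f (of_real x) * cnj (g (of_real x)))
      \<le> norm (1 / 2 * (norm (f (of_real x)))\<^sup>2 + 1 / 2 * (norm (g (of_real x)))\<^sup>2)"
    using norm_mult_le_weighted[of 1 "f (of_real _)" "cnj (g (of_real _))"] by (intro AE_I2) simp
qed

text \<open>The modulations have period 2 pi, so each integral unfolds to one of a modulation
  against the trigonometric polynomial with coefficients \<open>A j\<close>, that is, to 2 pi times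
  a combination of moments. The Toeplitz equations for \<open>v\<close> reduce the weighted total to
  the sum of the \<open>A j\<close>, the value at 0.\<close>

lemma integral_modulated_window:
  assumes f: "f \<in> PW t" and t: "t \<ge> 0" and ab: "\<alpha> \<le> \<beta>" "\<beta> \<le> \<alpha> + 1"
    and upper: "t + \<beta> \<le> 1" and lower: "t - \<alpha> \<le> real N"
    and v: "\<And>j. j < N \<Longrightarrow> (\<Sum>l<N. moment \<mu> (int l - int j) * v l) = 1"
  shows "integrable \<mu> (\<lambda>x. f (of_real x) * (\<Sum>l<N. v l / (2*pi) * (exp (- (\<i> * of_nat l * of_real x)) * window_ft \<alpha> \<beta> (of_real x))))"
    and "(LINT x|\<mu>. f (of_real x) * (\<Sum>l<N. v l / (2*pi) * (exp (- (\<i> * of_nat l * of_real x)) * window_ft \<alpha> \<beta> (of_real x))))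
      = periodization (\<lambda>z. f z * window_ft \<alpha> \<beta> z) 0"
proof -
  define G where "G z = f z * window_ft \<alpha> \<beta> z" for z
  obtain W A where W: "\<And>z k. (\<Sum>j<k. norm (G (z + of_real (2*pi*real j)))) \<le> W (Im z)"
    and A: "\<And>z. periodization G z = (\<Sum>j<N. A j * exp (\<i> * z) ^ j)"
    unfolding G_def using PW_window_periodization[OF f t ab upper lower] by blast
  have hol: "G holomorphic_on UNIV"
    unfolding G_def using f by (intro holomorphic_intros window_ft_holomorphic) (simp add: mem_PW_iff entire_of_type_def)
  have contG: "continuous_on UNIV (\<lambda>x::real. G (of_real x))"
    by (intro continuous_on_compose2[OF holomorphic_on_imp_continuous_on[OF hol]] continuous_intros) auto
  define h where "h l x = exp (- (\<i> * of_nat l * of_real x)) * G (of_real x)" for l :: nat and x :: real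
  define T where "T l x = exp (- (\<i> * of_nat l * of_real x)) * periodization G (of_real x)" for l :: nat and x :: real
  have cont: "continuous_on UNIV (h l)" for l
    unfolding h_def by (intro continuous_intros contG)
  have shifts: "h l (x + 2*pi*real i) = exp (- (\<i> * of_nat l * of_real x)) * G (of_real x + of_real (2*pi*real i))"
    "h l (x - 2*pi*real i) = exp (- (\<i> * of_nat l * of_real x)) * G (of_real x - of_real (2*pi*real i))" for l x i
    using exp_modulation_period[of l "of_real x" i] by (simp_all add: h_def)
  have bound: "(\<Sum>i<k. norm (h l (x + 2*pi*real i)) + norm (h l (x - 2*pi*real (Suc i)))) \<le> W 0" for l x k
    using symmetric_window_norm_sum_le[OF hol W, where k = k and z = "of_real x"] unfolding shifts by (simp add: norm_mult)
  have sums: "(\<lambda>i. h l (x + 2*pi*real i) + h l (x - 2*pi*real (Suc i))) sums T l x" for l x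
    unfolding shifts T_def distrib_left[symmetric] by (rule sums_mult[OF periodization_sums[OF hol W]])
  have inth: "integrable \<mu> (h l)" and Lh: "(LINT x|\<mu>. h l x) = (LINT x|period_measure \<mu>. T l x)" for l
    using integral_periodization[OF \<mu> cont bound sums] by auto
  have LT: "(LINT x|period_measure \<mu>. T l x) = (\<Sum>j<N. A j * (2 * pi * moment \<mu> (int l - int j)))" for l
  proof -
    have "(LINT x|period_measure \<mu>. T l x)
        = (LINT x|period_measure \<mu>. (\<Sum>j<N. A j * (exp (- (\<i> * of_nat l * of_real x)) * exp (\<i> * of_real x) ^ j)))"
      unfolding T_def A by (simp add: sum_distrib_left mult_ac)
    also have "\<dots> = (\<Sum>j<N. LINT x|period_measure \<mu>. A j * (exp (- (\<i> * of_nat l * of_real x)) * exp (\<i> * of_real x) ^ j))"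
      by (rule Bochner_Integration.integral_sum) (intro integrable_period_measure[OF \<mu>] continuous_intros)
    also have "\<dots> = (\<Sum>j<N. A j * (2 * pi * moment \<mu> (int l - int j)))"
      by (simp only: integral_mult_right_zero integral_exp_period_measure)
    finally show ?thesis .
  qed
  have eq: "f (of_real x) * (\<Sum>l<N. v l / (2*pi) * (exp (- (\<i> * of_nat l * of_real x)) * window_ft \<alpha> \<beta> (of_real x)))
      = (\<Sum>l<N. v l / (2*pi) * h l x)" for x
    by (simp add: h_def G_def sum_distrib_left mult_ac)
  show "integrable \<mu> (\<lambda>x. f (of_real x) * (\<Sum>l<N. v l / (2*pi) * (exp (- (\<i> * of_nat l * of_real x)) * window_ft \<alpha> \<beta> (of_real x))))"
    unfolding eq by (intro Bochner_Integration.integrable_sum integrable_mult_right inth)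
  have "(LINT x|\<mu>. f (of_real x) * (\<Sum>l<N. v l / (2*pi) * (exp (- (\<i> * of_nat l * of_real x)) * window_ft \<alpha> \<beta> (of_real x))))
      = (\<Sum>l<N. v l / (2*pi) * (\<Sum>j<N. A j * (2 * pi * moment \<mu> (int l - int j))))"
    unfolding eq by (subst Bochner_Integration.integral_sum) (auto simp: Lh LT intro!: integrable_mult_right inth)
  also have "\<dots> = (\<Sum>l<N. \<Sum>j<N. A j * (moment \<mu> (int l - int j) * v l))"
    by (simp add: sum_distrib_left mult_ac)
  also have "\<dots> = (\<Sum>j<N. A j * (\<Sum>l<N. moment \<mu> (int l - int j) * v l))"
    by (subst sum.swap) (simp add: sum_distrib_left)
  also have "\<dots> = periodization G 0" by (simp add: v A)
  finally show "(LINT x|\<mu>. f (of_real x) * (\<Sum>l<N. v l / (2*pi) * (exp (- (\<i> * of_nat l * of_real x)) * window_ft \<alpha> \<beta> (of_real x))))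
      = periodization (\<lambda>z. f z * window_ft \<alpha> \<beta> z) 0"
    by (simp add: G_def[abs_def])
qed

text \<open>Testing both kernels on their difference \<open>g\<close> gives a vanishing integral of
  |g|^2, so \<open>g\<close> is zero by \<open>entire_vanishing_on_support\<close>. This makes the
  description in \<open>PW_kernel\<close> definite.\<close>

lemma PW_kernel_unique:
  assumes t: "t \<ge> 0"
    and k: "k \<in> PW t" "\<And>f. f \<in> PW t \<Longrightarrow> f 0 = (LINT x|\<mu>. f (of_real x) * cnj (k (of_real x)))"
    and k': "k' \<in> PW t" "\<And>f. f \<in> PW t \<Longrightarrow> f 0 = (LINT x|\<mu>. f (of_real x) * cnj (k' (of_real x)))"
  shows "k = k'"
proof -
  define g where "g z = k z - k' z" for z
  have g: "g \<in> PW t" unfolding g_def[abs_def] by (rule PW_diff[OF k(1) k'(1)])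
  have "(LINT x|\<mu>. g (of_real x) * cnj (k (of_real x)) - g (of_real x) * cnj (k' (of_real x))) = 0"
    by (subst Bochner_Integration.integral_diff)
      (auto intro!: PW_product_integrable[OF g] k(1) k'(1) t simp: k(2)[OF g, symmetric] k'(2)[OF g, symmetric])
  moreover have eq: "g (of_real x) * cnj (k (of_real x)) - g (of_real x) * cnj (k' (of_real x))
      = of_real ((norm (g (of_real x)))\<^sup>2)" for x
    by (simp only: complex_norm_square) (simp add: g_def algebra_simps)
  ultimately have "(LINT x|\<mu>. (norm (g (of_real x)))\<^sup>2) = 0"
    unfolding eq integral_complex_of_real by simp
  then have "AE x in \<mu>. (norm (g (of_real x)))\<^sup>2 = 0"
    by (subst (asm) integral_nonneg_eq_0_iff_AE) (auto intro: PW_square_integrable[OF g t])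
  then have "AE x in period_measure \<mu>. (norm (g (of_real x)))\<^sup>2 = 0"
    by (subst AE_restrict_space_iff) (auto simp: sets_mu[OF \<mu>] space_mu[OF \<mu>])
  then have "(LINT x|period_measure \<mu>. (norm (g (of_real x)))\<^sup>2) = 0"
    by (rule integral_eq_zero_AE)
  moreover have "g holomorphic_on UNIV" using g by (simp add: mem_PW_iff entire_of_type_def)
  ultimately have "g z = 0" for z by (intro entire_vanishing_on_support[OF \<mu>])
  then show ?thesis by (simp add: g_def fun_eq_iff)
qed

end

section \<open>Toeplitz systems and the value of the kernel\<close>

context
  fixes \<mu> :: "real measure"
  assumes \<mu>: "periodic_sampling_measure \<mu>"
begin

text \<open>The quadratic form of the Toeplitz matrix at \<open>x\<close> is, up to 2 pi, the
  integral of |p|^2 over a period. If it vanishes then \<open>p\<close> is identically zero, and so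
  are its coefficients.\<close>

lemma toeplitz_injective:
  assumes zero: "\<And>j. j < N \<Longrightarrow> (\<Sum>l<N. moment \<mu> (int l - int j) * x l) = 0" and l: "l < N"
  shows "x l = 0"
proof -
  define p where "p z = (\<Sum>l<N. x l * exp (- (\<i> * of_nat l * z)))" for z
  have hol: "p holomorphic_on UNIV" unfolding p_def[abs_def] by (intro holomorphic_intros)
  have cnj_exp: "cnj (exp (- (\<i> * of_nat j * of_real y))) = exp (\<i> * of_real y) ^ j" for j and y :: real
    by (simp add: exp_cnj mult_ac flip: exp_of_nat_mult)
  have "complex_of_real (LINT y|period_measure \<mu>. (norm (p (of_real y)))\<^sup>2)
      = (LINT y|period_measure \<mu>. p (of_real y) * cnj (p (of_real y)))"
    by (subst integral_complex_of_real[symmetric], subst complex_norm_square) (rule refl)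
  also have "\<dots> = (LINT y|period_measure \<mu>. (\<Sum>l<N. \<Sum>j<N. x l * cnj (x j) * (exp (- (\<i> * of_nat l * of_real y)) * exp (\<i> * of_real y) ^ j)))"
    by (intro Bochner_Integration.integral_cong refl)
      (simp only: p_def cnj_sum complex_cnj_mult cnj_exp sum_product, simp add: mult_ac)
  also have "\<dots> = (\<Sum>l<N. LINT y|period_measure \<mu>. (\<Sum>j<N. x l * cnj (x j) * (exp (- (\<i> * of_nat l * of_real y)) * exp (\<i> * of_real y) ^ j)))"
    by (rule Bochner_Integration.integral_sum) (intro integrable_period_measure[OF \<mu>] continuous_intros)
  also have "\<dots> = (\<Sum>l<N. \<Sum>j<N. LINT y|period_measure \<mu>. x l * cnj (x j) * (exp (- (\<i> * of_nat l * of_real y)) * exp (\<i> * of_real y) ^ j))"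
    by (intro sum.cong refl Bochner_Integration.integral_sum integrable_period_measure[OF \<mu>] continuous_intros)
  also have "\<dots> = (\<Sum>l<N. \<Sum>j<N. x l * cnj (x j) * (2 * pi * moment \<mu> (int l - int j)))"
    by (simp only: integral_mult_right_zero integral_exp_period_measure[OF \<mu>])
  also have "\<dots> = (\<Sum>j<N. \<Sum>l<N. x l * cnj (x j) * (2 * pi * moment \<mu> (int l - int j)))"
    by (rule sum.swap)
  also have "\<dots> = (\<Sum>j<N. 2 * pi * cnj (x j) * (\<Sum>l<N. moment \<mu> (int l - int j) * x l))"
    by (simp add: sum_distrib_left mult_ac)
  also have "\<dots> = 0" by (simp add: zero)
  finally have p0: "p z = 0" for z by (intro entire_vanishing_on_support[OF \<mu> hol]) simp
  \<comment> \<open>The substitution z = i Ln w turns \<open>p\<close> into an ordinary polynomial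
    in w. Padding with the coefficient 0 at index \<open>N\<close> fits the range of
    \<open>polyfun_finite_roots\<close> and covers N = 0.\<close>
  have root: "(\<Sum>i\<le>N. (if i < N then x i else 0) * w ^ i) = 0" if "w \<noteq> 0" for w
  proof -
    have "exp (- (\<i> * of_nat k * (\<i> * Ln w))) = w ^ k" for k
    proof -
      have "\<i> * of_nat k * (\<i> * Ln w) = (\<i> * \<i>) * (of_nat k * Ln w)" by (simp only: mult_ac)
      then show ?thesis using that by (simp add: exp_of_nat_mult)
    qed
    then have "(\<Sum>i<N. x i * w ^ i) = p (\<i> * Ln w)" by (simp add: p_def)
    moreover have "(\<Sum>i\<le>N. (if i < N then x i else 0) * w ^ i) = (\<Sum>i<N. x i * w ^ i)"
      by (intro sum.mono_neutral_cong_right) auto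
    ultimately show ?thesis using p0 by simp
  qed
  have "infinite {w::complex. (\<Sum>i\<le>N. (if i < N then x i else 0) * w ^ i) = 0}"
  proof
    assume "finite {w::complex. (\<Sum>i\<le>N. (if i < N then x i else 0) * w ^ i) = 0}"
    then have "finite (UNIV - {0::complex})" by (rule rev_finite_subset) (use root in auto)
    then show False using infinite_UNIV_char_0[where 'a = complex] by simp
  qed
  then have "\<not> (\<exists>i\<le>N. (if i < N then x i else 0) \<noteq> 0)" unfolding polyfun_finite_roots .
  then have "(if l < N then x l else 0) = 0" using less_imp_le[OF l] by blast
  then show ?thesis using l by simp
qed

text \<open>Injectivity makes the matrix invertible, and the row sums of the inverse
  \<open>B\<close> form the solution with right-hand side (1, ..., 1); their total is the entry
  sum.\<close>

lemma toeplitz_solution: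
  obtains v where "\<And>j. j < N \<Longrightarrow> (\<Sum>l<N. moment \<mu> (int l - int j) * v l) = 1"
    "entry_sum (mat_inv (toeplitz \<mu> N)) = (\<Sum>l<N. v l)"
proof -
  define A where "A = toeplitz \<mu> N"
  have A: "A \<in> carrier_mat N N" by (simp add: A_def toeplitz_def)
  have A_entry: "A $$ (j, l) = moment \<mu> (int l - int j)" if "j < N" "l < N" for j l
    using that by (simp add: A_def toeplitz_def)
  have "det A \<noteq> 0"
  proof
    assume "det A = 0"
    then obtain w where w: "w \<in> carrier_vec N" "w \<noteq> 0\<^sub>v N" "A *\<^sub>v w = 0\<^sub>v N"
      using det_0_iff_vec_prod_zero_field[OF A] by auto
    have zero: "(\<Sum>l<N. moment \<mu> (int l - int j) * vec_index w l) = 0" if "j < N" for j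
    proof -
      have "vec_index (A *\<^sub>v w) j = 0" using w that by simp
      moreover have "vec_index (A *\<^sub>v w) j = (\<Sum>l<N. moment \<mu> (int l - int j) * vec_index w l)"
        using that A w(1) by (simp add: scalar_prod_def A_entry atLeast0LessThan)
      ultimately show ?thesis by simp
    qed
    have "w = 0\<^sub>v N"
      by (rule eq_vecI) (use toeplitz_injective[of N "vec_index w", OF zero] w in auto)
    with w show False by simp
  qed
  then have "A \<in> Units (ring_mat TYPE(complex) N ())" by (rule det_non_zero_imp_unit[OF A])
  then obtain B where B: "B \<in> carrier_mat N N" "A * B = 1\<^sub>m N" "B * A = 1\<^sub>m N"
    by (auto simp: Units_def ring_mat_simps)
  have "mat_inv A = B"
    unfolding mat_inv_def
  proof (rule the_equality)
    show "inverts_mat A B \<and> inverts_mat B A \<and> B \<in> carrier_mat (dim_col A) (dim_row A)"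
      using A B by (auto simp: inverts_mat_def)
    fix C assume "inverts_mat A C \<and> inverts_mat C A \<and> C \<in> carrier_mat (dim_col A) (dim_row A)"
    then have C: "C \<in> carrier_mat N N" "C * A = 1\<^sub>m N" using A by (auto simp: inverts_mat_def)
    have "C = C * (A * B)" using B C by simp
    also have "\<dots> = (C * A) * B" using assoc_mult_mat[OF C(1) A B(1)] by simp
    finally show "C = B" using B C by simp
  qed
  define v where "v l = (\<Sum>m<N. B $$ (l, m))" for l
  have "(\<Sum>l<N. moment \<mu> (int l - int j) * v l) = 1" if j: "j < N" for j
  proof -
    have "(\<Sum>l<N. moment \<mu> (int l - int j) * v l) = (\<Sum>m<N. \<Sum>l<N. A $$ (j, l) * B $$ (l, m))"
      unfolding v_def sum_distrib_left by (subst sum.swap) (simp add: A_entry j)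
    also have "\<dots> = (\<Sum>m<N. (A * B) $$ (j, m))"
      using A B(1) j by (intro sum.cong refl) (simp add: scalar_prod_def atLeast0LessThan)
    also have "\<dots> = (\<Sum>m<N. if m = j then 1 else 0)" unfolding B(2) using j by (intro sum.cong) auto
    also have "\<dots> = 1" using j by simp
    finally show ?thesis .
  qed
  moreover have "entry_sum (mat_inv (toeplitz \<mu> N)) = (\<Sum>l<N. v l)"
    using \<open>mat_inv A = B\<close> B(1) unfolding A_def
    by (simp add: entry_sum_def v_def sum.cartesian_product atLeast0LessThan)
  ultimately show ?thesis using that by blast
qed

text \<open>The conjugated sum equals the quadratic form of the matrix at \<open>v\<close>, because
  each row applied to \<open>v\<close> gives 1. The matrix is Hermitian, so the form is
  real.\<close>

lemma toeplitz_solution_sum_real: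
  assumes v: "\<And>j. j < N \<Longrightarrow> (\<Sum>l<N. moment \<mu> (int l - int j) * v l) = 1"
  shows "cnj (\<Sum>l<N. v l) = (\<Sum>l<N. v l)"
proof -
  define Q where "Q = (\<Sum>j<N. \<Sum>l<N. cnj (v j) * (moment \<mu> (int l - int j) * v l))"
  have "(\<Sum>j<N. cnj (v j)) = Q"
    unfolding Q_def sum_distrib_left[symmetric] by (simp add: v)
  moreover have "cnj Q = Q"
  proof -
    have "cnj Q = (\<Sum>j<N. \<Sum>l<N. cnj (v l) * (moment \<mu> (int j - int l) * v j))"
      by (simp add: Q_def moment_cnj[OF \<mu>] mult_ac)
    also have "\<dots> = Q" unfolding Q_def by (rule sum.swap)
    finally show ?thesis .
  qed
  ultimately show ?thesis by (metis cnj_sum complex_cnj_cnj)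
qed

lemma PW_kernel_at_0:
  assumes t: "real n / 2 < t" "t < (real n + 1) / 2"
    and v: "\<And>j. j < n + 1 \<Longrightarrow> (\<Sum>l<n + 1. moment \<mu> (int l - int j) * v l) = 1"
    and u: "\<And>j. j < n \<Longrightarrow> (\<Sum>l<n. moment \<mu> (int l - int j) * u l) = 1"
  shows "PW_kernel \<mu> t 0 = (of_real (2*t - real n) * (\<Sum>l<n + 1. v l) + of_real (1 - (2*t - real n)) * (\<Sum>l<n. u l)) / (2*pi)"
proof -
  define r where "r = 2*t - real n"
  \<comment> \<open>The intervals [a + l, b + l] for l = 0, ..., n and [b + l, a + 1 + l] for l = 0,
    ..., n - 1 tile [-t, t], since b + n = t. They carry the values v_l / (2 pi) and u_l / (2
    pi).\<close>
  define a b where "a = - t" and "b = - t + r"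
  have r: "0 < r" "r < 1" using t by (auto simp: r_def field_simps)
  have t0: "t \<ge> 0" using t by (smt (verit) divide_nonneg_nonneg of_nat_0_le_iff)
  have ab: "a \<le> b" "b \<le> a + 1" "a + 1 \<le> b + 1" using r by (auto simp: a_def b_def)
  define K1 where "K1 z = (\<Sum>l<n + 1. v l / (2*pi) * (exp (- (\<i> * of_nat l * z)) * window_ft a b z))" for z
  define K2 where "K2 z = (\<Sum>l<n. u l / (2*pi) * (exp (- (\<i> * of_nat l * z)) * window_ft b (a + 1) z))" for z
  \<comment> \<open>\<open>K1 + K2\<close> represents evaluation at 0 without conjugation, whereas
    \<open>PW_kernel\<close> pairs with the conjugate; hence the reflection.\<close>
  define k where "k z = cnj (K1 (cnj z) + K2 (cnj z))" for z
  have "K1 \<in> PW t" unfolding K1_def[abs_def]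
    by (intro PW_sum PW_cmult modulated_window_ft_in_PW ab) (auto simp: a_def b_def r_def)
  moreover have "K2 \<in> PW t" unfolding K2_def[abs_def]
    by (intro PW_sum PW_cmult modulated_window_ft_in_PW ab) (use r in \<open>auto simp: a_def b_def r_def\<close>)
  ultimately have kPW: "k \<in> PW t"
    unfolding k_def[abs_def] by (intro PW_reflect[of "\<lambda>z. K1 z + K2 z"] PW_add)
  have kK: "cnj (k (of_real x)) = K1 (of_real x) + K2 (of_real x)" for x by (simp add: k_def)
  have repr: "f 0 = (LINT x|\<mu>. f (of_real x) * cnj (k (of_real x)))" if f: "f \<in> PW t" for f
  proof -
    have "t + b \<le> 1" "t - a \<le> real (n + 1)" using r by (auto simp: a_def b_def r_def)
    note 1 = integral_modulated_window[OF \<mu> f t0 ab(1,2) this v]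
    \<comment> \<open>Both bounds are attained for the second window. For n = 0 the system is empty,
      \<open>K2\<close> is zero and the periodization over this window vanishes as well.\<close>
    have "t + (a + 1) \<le> 1" "t - b \<le> real n" by (auto simp: a_def b_def r_def)
    note 2 = integral_modulated_window[OF \<mu> f t0 ab(2,3) this u]
    have "(LINT x|\<mu>. f (of_real x) * cnj (k (of_real x)))
        = (LINT x|\<mu>. f (of_real x) * K1 (of_real x) + f (of_real x) * K2 (of_real x))"
      unfolding kK distrib_left ..
    also have "\<dots> = (LINT x|\<mu>. f (of_real x) * K1 (of_real x)) + (LINT x|\<mu>. f (of_real x) * K2 (of_real x))"
      unfolding K1_def K2_def by (rule Bochner_Integration.integral_add[OF 1(1) 2(1)])
    also have "\<dots> = periodization (\<lambda>z. f z * window_ft a b z) 0 + periodization (\<lambda>z. f z * window_ft b (a + 1) z) 0"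
      unfolding K1_def K2_def by (rule arg_cong2[of _ _ _ _ "(+)", OF 1(2) 2(2)])
    also have "\<dots> = f 0" by (rule periodization_split_unit_window[OF f t0 ab(1,2)])
    finally show ?thesis ..
  qed
  have "PW_kernel \<mu> t = k"
    unfolding PW_kernel_def
  proof (rule the_equality)
    fix k' assume "k' \<in> PW t \<and> (\<forall>f\<in>PW t. f 0 = (LINT x|\<mu>. f (of_real x) * cnj (k' (of_real x))))"
    then show "k' = k" by (intro PW_kernel_unique[OF \<mu> t0 _ _ kPW repr]) auto
  qed (use kPW repr in blast)
  moreover have "k 0 = cnj ((of_real r * (\<Sum>l<n + 1. v l) + of_real (1 - r) * (\<Sum>l<n. u l)) / (2*pi))"
  proof -
    have "window_ft a b 0 = of_real r" "window_ft b (a + 1) 0 = of_real (1 - r)"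
      using ab by (simp_all add: window_ft_0) (simp_all add: a_def b_def)
    then have "K1 0 = of_real r * (\<Sum>l<n + 1. v l) / (2*pi)" "K2 0 = of_real (1 - r) * (\<Sum>l<n. u l) / (2*pi)"
      unfolding K1_def K2_def by (simp_all only: sum_distrib_left sum_divide_distrib) (simp_all add: mult_ac)
    then show ?thesis by (simp add: k_def add_divide_distrib)
  qed
  moreover have "cnj (\<Sum>l<n + 1. v l) = (\<Sum>l<n + 1. v l)" "cnj (\<Sum>l<n. u l) = (\<Sum>l<n. u l)"
    by (rule toeplitz_solution_sum_real[OF v] toeplitz_solution_sum_real[OF u]; assumption)+
  ultimately show ?thesis unfolding r_def
    by (simp only: complex_cnj_divide complex_cnj_add complex_cnj_mult complex_cnj_complex_of_real complex_cnj_numeral)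
qed

end

section \<open>Slope of the affine kernel value on each interval\<close>

theorem mainTheorem17:
  fixes \<mu> :: "real measure"
  assumes "periodic_sampling_measure \<mu>"
  shows "\<exists>h :: nat \<Rightarrow> complex.
     (\<forall>n t. real n / 2 < t \<and> t < (real n + 1) / 2 \<longrightarrow>
        ((\<lambda>s. PW_kernel \<mu> s 0) has_vector_derivative (h n / of_real pi)) (at t)) \<and>
     h 0 = entry_sum (mat_inv (toeplitz \<mu> 1)) \<and>
     h 0 = 1 / moment \<mu> 0 \<and>
     (\<forall>n\<ge>1. h n = entry_sum (mat_inv (toeplitz \<mu> (n+1))) - entry_sum (mat_inv (toeplitz \<mu> n)))"
proof -
  have "\<forall>N. \<exists>v. (\<forall>j<N. (\<Sum>l<N. moment \<mu> (int l - int j) * v l) = 1) \<and>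
      entry_sum (mat_inv (toeplitz \<mu> N)) = (\<Sum>l<N. v l)"
    using toeplitz_solution[OF assms] by metis
  then obtain v where v: "\<And>N j. j < N \<Longrightarrow> (\<Sum>l<N. moment \<mu> (int l - int j) * v N l) = 1"
    and sum_v: "\<And>N. entry_sum (mat_inv (toeplitz \<mu> N)) = (\<Sum>l<N. v N l)"
    by metis
  define \<sigma> where "\<sigma> N = (\<Sum>l<N. v N l)" for N
  \<comment> \<open>For n = 0 the subtracted term is an empty sum, so the same formula covers the
    first interval.\<close>
  define h where "h n = \<sigma> (n + 1) - \<sigma> n" for n
  have "((\<lambda>s. PW_kernel \<mu> s 0) has_vector_derivative (h n / of_real pi)) (at t)"
    if t: "real n / 2 < t" "t < (real n + 1) / 2" for n t
  proof (rule has_vector_derivative_transform_within_open)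
    \<comment> \<open>The kernel value collected by powers of \<open>s\<close>: the coefficient 2 of
      \<open>s\<close> in 2 s - n cancels against the denominator 2 pi and leaves the slope
      \<open>h n\<close> / pi.\<close>
    let ?g = "\<lambda>s::real. s *\<^sub>R (h n / of_real pi) + (\<sigma> n - of_nat n * h n) / (2*pi)"
    show "(?g has_vector_derivative (h n / of_real pi)) (at t)"
      by (auto intro!: derivative_eq_intros)
    show "open {real n / 2<..<(real n + 1) / 2}" "t \<in> {real n / 2<..<(real n + 1) / 2}" using t by auto
    fix s assume "s \<in> {real n / 2<..<(real n + 1) / 2}"
    then have "PW_kernel \<mu> s 0 = (of_real (2 * s - real n) * \<sigma> (n + 1) + of_real (1 - (2 * s - real n)) * \<sigma> n) / (2*pi)"
      unfolding \<sigma>_def by (intro PW_kernel_at_0[OF assms _ _ v v]) auto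
    also have "\<dots> = ?g s" by (simp add: h_def scaleR_conv_of_real field_simps)
    finally show "?g s = PW_kernel \<mu> s 0" ..
  qed
  moreover have h0: "h 0 = \<sigma> 1" by (simp add: h_def \<sigma>_def)
  \<comment> \<open>The system of size 1 reads \<open>moment \<mu> 0 * v 1 0 = 1\<close>, which also
    shows that the moment is nonzero.\<close>
  moreover have "\<sigma> 1 = 1 / moment \<mu> 0"
    using v[of 0 1] by (simp add: \<sigma>_def eq_divide_eq mult.commute) (metis mult_zero_left zero_neq_one)
  ultimately show ?thesis
    unfolding sum_v \<sigma>_def[symmetric] by (intro exI[of _ h]) (auto simp: h_def)
qed

end
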